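(* A functional $Z\colon \mathrm{Conv}_{\rm sc}(\mathbb{R})\to\mathbb{R}$ is a continuous and epi-translation invariant valuation if and only if there exist a constant $\zeta_0\in\mathbb{R}$ and a function $\zeta_1\in C_c(\mathbb{R})$ such that $$Z(u)=\zeta_0+\int_{\mathrm{dom}(u)}\zeta_1(u'(x))\,dx$$ for every $u\in\mathrm{Conv}_{\rm sc}(\mathbb{R})$.
   Context: $\mathrm{Conv}(\mathbb{R})$ is the set of convex, lower semicontinuous functions $u\colon\mathbb{R}\to\mathbb{R}\cup\{+\infty\}$ with $u\not\equiv+\infty$. $\mathrm{Conv}_{\rm sc}(\mathbb{R})$ is the subset of super-coercive functions, i.e. those with $\lim_{|x|\to+\infty}u(x)/|x|=+\infty$. Topology: continuity is with respect to epi-convergence. A sequence $u_k$ epi-converges to $u$ if for every $x\in\mathbb{R}$: (i) $u(x)\le\liminf_{k\to\infty}u_k(x_k)$ for every sequence $x_k\to x$, and (ii) there is a sequence $x_k\to x$ with $u(x)=\lim_{k\to\infty}u_k(x_k)$. A functional $Z\colon X\to\mathbb{R}$ on a set $X$ of functions is a valuation if $Z(u\vee v)+Z(u\wedge v)=Z(u)+Z(v)$ for all $u,v\in X$ with $u\vee v\in X$ and $u\wedge v\in X$, where $\vee$ and $\wedge$ denote pointwise maximum and minimum. $Z$ is epi-translation invariant if it is translation invariant ($Z(u\circ\tau^{-1})=Z(u)$ for all $u$ and all translations $\tau\colon\mathbb{R}\to\mathbb{R}$) and vertically translation invariant ($Z(u+\alpha)=Z(u)$ for all $u$ and all constants $\alpha\in\mathbb{R}$).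 $\mathrm{dom}(u)$ is the set of points where $u$ is finite; $u'$ is the derivative, which exists at almost every point of $\mathrm{dom}(u)$. $C_c(\mathbb{R})$ is the set of continuous real-valued functions on $\mathbb{R}$ with compact support. *)

theory Defs
  imports "HOL-Analysis.Analysis"
begin

(* The products are taken in ereal, where 0 * \<infinity> = 0, so t = 0 and t = 1 are harmless. The value
   -\<infinity> is excluded separately in Conv. *)
definition ereal_convex :: "(real \<Rightarrow> ereal) \<Rightarrow> bool" where
  "ereal_convex u \<longleftrightarrow>
     (\<forall>x y. \<forall>t\<in>{0..1}. u ((1 - t) * x + t * y) \<le> ereal (1 - t) * u x + ereal t * u y)"

definition lower_semicontinuous :: "(real \<Rightarrow> ereal) \<Rightarrow> bool" where
  "lower_semicontinuous u \<longleftrightarrow> (\<forall>x. u x \<le> Liminf (at x) u)"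

definition Conv :: "(real \<Rightarrow> ereal) set" where
  "Conv = {u. (\<forall>x. u x \<noteq> -\<infinity>) \<and> ereal_convex u \<and> lower_semicontinuous u \<and> (\<exists>x. u x \<noteq> \<infinity>)}"

definition super_coercive :: "(real \<Rightarrow> ereal) \<Rightarrow> bool" where
  "super_coercive u \<longleftrightarrow> ((\<lambda>x. u x / ereal \<bar>x\<bar>) \<longlongrightarrow> \<infinity>) at_infinity"

definition Conv_sc :: "(real \<Rightarrow> ereal) set" where
  "Conv_sc = {u \<in> Conv. super_coercive u}"

definition epi_converges :: "(nat \<Rightarrow> real \<Rightarrow> ereal) \<Rightarrow> (real \<Rightarrow> ereal) \<Rightarrow> bool" where
  "epi_converges us u \<longleftrightarrow>
     (\<forall>x. (\<forall>xs. xs \<longlonglongrightarrow> x \<longrightarrow> u x \<le> liminf (\<lambda>k. us k (xs k))) \<and>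
          (\<exists>xs. xs \<longlonglongrightarrow> x \<and> (\<lambda>k. us k (xs k)) \<longlonglongrightarrow> u x))"

(* A functional on a set X of functions is a total function of which only the values on X matter. *)

definition epi_continuous_on ::
    "(real \<Rightarrow> ereal) set \<Rightarrow> ((real \<Rightarrow> ereal) \<Rightarrow> real) \<Rightarrow> bool" where
  "epi_continuous_on X Z \<longleftrightarrow>
     (\<forall>us. \<forall>u\<in>X. (\<forall>k. us k \<in> X) \<longrightarrow> epi_converges us u \<longrightarrow> (\<lambda>k. Z (us k)) \<longlonglongrightarrow> Z u)"

(* sup and inf on functions are the pointwise maximum and minimum. *)
definition valuation_on ::
    "(real \<Rightarrow> ereal) set \<Rightarrow> ((real \<Rightarrow> ereal) \<Rightarrow> real) \<Rightarrow> bool" where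
  "valuation_on X Z \<longleftrightarrow>
     (\<forall>u\<in>X. \<forall>v\<in>X. sup u v \<in> X \<longrightarrow> inf u v \<in> X \<longrightarrow> Z (sup u v) + Z (inf u v) = Z u + Z v)"

definition translation_invariant_on ::
    "(real \<Rightarrow> ereal) set \<Rightarrow> ((real \<Rightarrow> ereal) \<Rightarrow> real) \<Rightarrow> bool" where
  "translation_invariant_on X Z \<longleftrightarrow> (\<forall>u\<in>X. \<forall>a::real. Z (\<lambda>x. u (x - a)) = Z u)"

definition vertically_translation_invariant_on ::
    "(real \<Rightarrow> ereal) set \<Rightarrow> ((real \<Rightarrow> ereal) \<Rightarrow> real) \<Rightarrow> bool" where
  "vertically_translation_invariant_on X Z \<longleftrightarrow> (\<forall>u\<in>X. \<forall>\<alpha>::real. Z (\<lambda>x. u x + ereal \<alpha>) = Z u)"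

definition epi_translation_invariant_on ::
    "(real \<Rightarrow> ereal) set \<Rightarrow> ((real \<Rightarrow> ereal) \<Rightarrow> real) \<Rightarrow> bool" where
  "epi_translation_invariant_on X Z \<longleftrightarrow>
     translation_invariant_on X Z \<and> vertically_translation_invariant_on X Z"

definition effective_dom :: "(real \<Rightarrow> ereal) \<Rightarrow> real set" where
  "effective_dom u = {x. \<bar>u x\<bar> \<noteq> \<infinity>}"

(* For u in Conv this is u' at the points of differentiability in the interior of the effective
   domain; the remaining points of the effective domain form a countable set, where the value is
   irrelevant under an integral. *)
definition ereal_deriv :: "(real \<Rightarrow> ereal) \<Rightarrow> real \<Rightarrow> real" where
  "ereal_deriv u x = deriv (\<lambda>y. real_of_ereal (u y)) x"

definition C_c :: "(real \<Rightarrow> real) set" where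
  "C_c = {f. continuous_on UNIV f \<and> compact (closure {x. f x \<noteq> 0})}"

end

(* A convex function has a unique subgradient, equal to its derivative, at all but countably many
   points of its domain, and subgradients behave well under epi-convergence, minima and maxima. Hence
   an integral functional is continuous by dominated convergence, super-coercivity confining slopes
   in the support of the density to a bounded set. It is a valuation because the integrands of
   max(u, v) and min(u, v) are, pointwise, those of u and v in some order.

   Conversely, splitting an interval shows that the value of Z on the function of slope t on [0, b]
   (infinite elsewhere), minus its value on the indicator of a point, is additive and continuous in b,
   hence of the form density(t) * b. If density did not vanish for large |t|, pieces of slope t and
   length 1 / |density t| would epi-converge to the indicator of a point and contradict continuity.
   The difference of Z and the integral functional with this density vanishes on piecewise affine
   functions on compact intervals, and these are dense in Conv_sc. *)

theory Submission
  imports Defs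
begin

text \<open>Derivatives are handled through the subgradient inequality. \<open>deriv\<close> has an
  unspecified value where no derivative exists and says nothing about limits, whereas a subgradient
  is a global inequality that can be tested at one well-chosen point. Such tests survive
  epi-convergence, and at a point of contact they pass from a smaller function to a larger one. The
  way back to \<open>ereal_deriv\<close> leads through the countable set \<open>kinks\<close>, so
  all identities between integrands hold almost everywhere. The integral of a non-integrable
  function is 0 by convention, so integrability needs a proof; it falls out of dominated convergence
  for a constant sequence. In the converse, two adjacent pieces share one point, and their maximum
  is finite exactly there. This is why the value at a point has to be subtracted to obtain an
  additive quantity, and that value becomes \<open>\<zeta>\<^sub>0\<close>. The density claim takes
  two approximations, cutting off at a height and interpolating by chords. Both are from above, so
  the liminf half of epi-convergence reduces to semicontinuity of the limit and only recovery
  sequences have to be found.\<close>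

section \<open>Convex functions with values in the extended reals\<close>

lemma mem_effective_dom_iff:
  assumes "u \<in> Conv"
  shows "x \<in> effective_dom u \<longleftrightarrow> (\<exists>r. u x = ereal r)"
  using assms by (cases "u x") (auto simp: effective_dom_def Conv_def)

lemma effective_domE:
  assumes "u \<in> Conv" "x \<in> effective_dom u"
  obtains r where "u x = ereal r"
  using assms mem_effective_dom_iff by blast

lemma Conv_not_MInfty: "u \<in> Conv \<Longrightarrow> u x \<noteq> -\<infinity>"
  by (auto simp: Conv_def)

lemma not_mem_effective_dom:
  assumes "u \<in> Conv" "x \<notin> effective_dom u"
  shows "u x = \<infinity>"
  using assms Conv_not_MInfty[of u x] by (auto simp: effective_dom_def)

lemma effective_domI_le:
  assumes "u \<in> Conv" "u x \<le> ereal r"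
  shows "x \<in> effective_dom u"
proof (rule ccontr)
  assume "x \<notin> effective_dom u"
  then have "u x = \<infinity>"
    using assms(1) by (rule not_mem_effective_dom[rotated])
  then show False
    using assms(2) by simp
qed

lemma effective_dom_nonempty:
  assumes "u \<in> Conv"
  obtains p where "p \<in> effective_dom u"
proof -
  obtain x where "u x \<noteq> \<infinity>"
    using assms by (auto simp: Conv_def)
  then show thesis
    using that not_mem_effective_dom[OF assms] by blast
qed

text \<open>Real upper bounds in place of the values keep later estimates in real arithmetic and
  apply equally when only a bound is known.\<close>

lemma Conv_le_convex_combination:
  assumes "u \<in> Conv" "u x \<le> ereal p" "u y \<le> ereal q" "0 \<le> t" "t \<le> 1"
  shows "u ((1 - t) * x + t * y) \<le> ereal ((1 - t) * p + t * q)"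
proof -
  have "u ((1 - t) * x + t * y) \<le> ereal (1 - t) * u x + ereal t * u y"
    using assms by (auto simp: Conv_def ereal_convex_def)
  also have "\<dots> \<le> ereal (1 - t) * ereal p + ereal t * ereal q"
    using assms by (intro add_mono ereal_mult_left_mono) auto
  finally show ?thesis by simp
qed

lemma Conv_le_chord:
  assumes "u \<in> Conv" "u x \<le> ereal p" "u y \<le> ereal q" "x \<noteq> y" "z \<in> closed_segment x y"
  shows "u z \<le> ereal (p + (q - p) / (y - x) * (z - x))"
proof -
  obtain t where t: "0 \<le> t" "t \<le> 1" "z = (1 - t) * x + t * y"
    using assms(5) by (auto simp: in_segment)
  have "z - x = t * (y - x)"
    using t by (simp add: algebra_simps)
  then have "(q - p) / (y - x) * (z - x) = t * (q - p)"
    using assms(4) by simp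
  then have "p + (q - p) / (y - x) * (z - x) = (1 - t) * p + t * q"
    by (simp only:) (simp add: algebra_simps)
  then show ?thesis
    using Conv_le_convex_combination[OF assms(1-3) t(1,2)] t(3) by simp
qed

lemma convex_effective_dom:
  assumes "u \<in> Conv"
  shows "convex (effective_dom u)"
proof -
  have "(1 - t) * x + t * y \<in> effective_dom u"
    if xy: "x \<in> effective_dom u" "y \<in> effective_dom u" and t: "0 \<le> t" "t \<le> 1" for x y t
  proof -
    obtain p q where "u x = ereal p" "u y = ereal q"
      using xy assms effective_domE by metis
    then show ?thesis
      using Conv_le_convex_combination[OF assms _ _ t, of x p y q] effective_domI_le[OF assms] by simp
  qed
  then show ?thesis
    by (auto simp: convex_alt)
qed

lemma effective_dom_between:
  assumes "u \<in> Conv" "a \<in> effective_dom u" "b \<in> effective_dom u" "a \<le> x" "x \<le> b"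
  shows "x \<in> effective_dom u"
  using convex_effective_dom[OF assms(1)] assms(2-)
  unfolding is_interval_convex_1[symmetric] is_interval_1 by blast

lemma convex_on_effective_dom:
  assumes "u \<in> Conv"
  shows "convex_on (effective_dom u) (\<lambda>x. real_of_ereal (u x))"
proof (rule convex_onI)
  fix t x y :: real
  assume t: "0 < t" "t < 1" and xy: "x \<in> effective_dom u" "y \<in> effective_dom u"
  then obtain p q where pq: "u x = ereal p" "u y = ereal q"
    using assms effective_domE by metis
  have "u ((1 - t) * x + t * y) \<le> ereal ((1 - t) * p + t * q)"
    using Conv_le_convex_combination[OF assms, of x p y q t] pq t by simp
  then show "real_of_ereal (u ((1 - t) *\<^sub>R x + t *\<^sub>R y))
      \<le> (1 - t) * real_of_ereal (u x) + t * real_of_ereal (u y)"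
    using pq Conv_not_MInfty[OF assms] by (cases "u ((1 - t) * x + t * y)") auto
qed (rule convex_effective_dom[OF assms])

section \<open>Working forms of lower semicontinuity and super-coercivity\<close>

lemma lower_semicontinuousD:
  assumes "lower_semicontinuous u" "c < u x"
  shows "\<forall>\<^sub>F y in nhds x. c < u y"
proof -
  have "\<forall>\<^sub>F y in at x. c < u y"
    using assms unfolding lower_semicontinuous_def le_Liminf_iff by blast
  \<comment> \<open>The Liminf in the definition ignores \<open>x\<close> itself; the second
    assumption covers that point.\<close>
  then show ?thesis
    using assms(2) by (auto simp: eventually_at_filter elim: eventually_mono)
qed

text \<open>Real levels and a non-strict conclusion suffice, because a real number fits between any
  \<open>c\<close> and \<open>u x\<close>.\<close>

lemma lower_semicontinuousI:
  assumes "\<And>x c. ereal c < u x \<Longrightarrow> \<forall>\<^sub>F y in nhds x. ereal c \<le> u y"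
  shows "lower_semicontinuous u"
  unfolding lower_semicontinuous_def le_Liminf_iff
proof (intro allI impI)
  fix x and c :: ereal assume "c < u x"
  then obtain d where d: "c < ereal d" "ereal d < u x"
    using ereal_dense2 by blast
  show "\<forall>\<^sub>F y in at x. c < u y"
    using assms[OF d(2)] d(1)
    by (auto simp: eventually_at_filter elim!: eventually_mono intro: less_le_trans)
qed

lemma super_coercive_iff:
  "super_coercive u \<longleftrightarrow> (\<forall>M. \<exists>R. \<forall>x. R \<le> \<bar>x\<bar> \<longrightarrow> ereal (M * \<bar>x\<bar>) \<le> u x)"
  (is "_ \<longleftrightarrow> ?R")
proof
  assume sc: "super_coercive u"
  show ?R
  proof
    fix M
    have "\<forall>\<^sub>F x in at_infinity. ereal M < u x / ereal \<bar>x\<bar>"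
      using sc by (auto simp: super_coercive_def tendsto_PInfty)
    then obtain R where R: "\<And>x. R \<le> \<bar>x\<bar> \<Longrightarrow> ereal M < u x / ereal \<bar>x\<bar>"
      unfolding eventually_at_infinity real_norm_def by blast
    have "ereal (M * \<bar>x\<bar>) \<le> u x" if "max R 1 \<le> \<bar>x\<bar>" for x
      using R[of x] that by (cases "u x") (auto simp: pos_less_divide_eq less_imp_le split: if_splits)
    then show "\<exists>R. \<forall>x. R \<le> \<bar>x\<bar> \<longrightarrow> ereal (M * \<bar>x\<bar>) \<le> u x"
      by blast
  qed
next
  assume R: ?R
  show "super_coercive u"
    unfolding super_coercive_def tendsto_PInfty
  proof
    fix M
    \<comment> \<open>The slope \<open>M + 1\<close> turns the non-strict bound into the strict one
      required; \<open>max R 1\<close> below keeps the divisor positive.\<close>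
    obtain R where R: "\<And>x. R \<le> \<bar>x\<bar> \<Longrightarrow> ereal ((M + 1) * \<bar>x\<bar>) \<le> u x"
      using R by blast
    have "ereal M < u x / ereal \<bar>x\<bar>" if "max R 1 \<le> \<bar>x\<bar>" for x
      using R[of x] that by (cases "u x") (auto simp: pos_less_divide_eq algebra_simps split: if_splits)
    then show "\<forall>\<^sub>F x in at_infinity. ereal M < u x / ereal \<bar>x\<bar>"
      unfolding eventually_at_infinity real_norm_def by blast
  qed
qed

lemma super_coerciveI_bounded:
  assumes "bounded (effective_dom u)" "u \<in> Conv"
  shows "super_coercive u"
proof -
  obtain B where "\<And>x. x \<in> effective_dom u \<Longrightarrow> \<bar>x\<bar> \<le> B"
    using assms(1) by (auto simp: bounded_iff)
  then have "u x = \<infinity>" if "B + 1 \<le> \<bar>x\<bar>" for x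
    using not_mem_effective_dom[OF assms(2)] that by fastforce
  then show ?thesis
    unfolding super_coercive_iff by (metis ereal_less_eq(1))
qed

section \<open>Subgradients\<close>

text \<open>Membership in the subdifferential. Finiteness of the value is built in, so there are no
  subgradients outside the effective domain.\<close>

definition subgrad :: "(real \<Rightarrow> ereal) \<Rightarrow> real \<Rightarrow> real \<Rightarrow> bool" where
  "subgrad u x s \<longleftrightarrow> (\<exists>r. u x = ereal r \<and> (\<forall>y. ereal (r + s * (y - x)) \<le> u y))"

text \<open>Each subgradient inequality is tested at the other point; adding the two cancels the
  function values.\<close>

lemma subgrad_mono:
  assumes "subgrad u x s" "subgrad u y t" "x < y"
  shows "s \<le> t"
proof -
  obtain p q where p: "u x = ereal p" "\<And>y. ereal (p + s * (y - x)) \<le> u y"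
    and q: "u y = ereal q" "\<And>z. ereal (q + t * (z - y)) \<le> u z"
    using assms by (auto simp: subgrad_def)
  have "s * (y - x) \<le> t * (y - x)"
    using p(2)[of y] q(2)[of x] p(1) q(1) by (simp add: algebra_simps)
  then show ?thesis
    using assms(3) by simp
qed

text \<open>The interiors of the subdifferentials at distinct points are disjoint, so a nondegenerate
  subdifferential is determined by any rational number in its interior.\<close>

lemma countable_nonunique_subgrad:
  "countable {x. \<exists>s t. s < t \<and> subgrad u x s \<and> subgrad u x t}" (is "countable ?N")
proof -
  have "\<forall>x\<in>?N. \<exists>q::rat. \<exists>s t. s < of_rat q \<and> of_rat q < t \<and> subgrad u x s \<and> subgrad u x t"
  proof
    fix x assume x: "x \<in> ?N" 
    obtain s t where st: "s < t" "subgrad u x s" "subgrad u x t"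
      using x by blast
    obtain q where "s < of_rat q" "of_rat q < t"
      using of_rat_dense[OF st(1)] by auto
    then show "\<exists>q::rat. \<exists>s t. s < of_rat q \<and> of_rat q < t \<and> subgrad u x s \<and> subgrad u x t"
      using st by blast
  qed
  from bchoice[OF this] obtain q :: "real \<Rightarrow> rat"
    where q: "\<forall>x\<in>?N. \<exists>s t. s < of_rat (q x) \<and> of_rat (q x) < t \<and> subgrad u x s \<and> subgrad u x t" ..
  have neq: "q x \<noteq> q y" if xy: "x \<in> ?N" "y \<in> ?N" "x < y" for x y
  proof -
    obtain t s where "of_rat (q x) < t" "s < of_rat (q y)" "subgrad u x t" "subgrad u y s"
      using bspec[OF q xy(1)] bspec[OF q xy(2)] by blast
    moreover from this have "t \<le> s"
      using subgrad_mono xy(3) by blast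
    ultimately have "(of_rat (q x) :: real) < of_rat (q y)"
      by linarith
    then show ?thesis
      by (metis less_irrefl)
  qed
  have "inj_on q ?N"
  proof (rule inj_onI)
    fix x y assume "x \<in> ?N" "y \<in> ?N" "q x = q y"
    then show "x = y"
      using neq[of x y] neq[of y x] by (cases x y rule: linorder_cases) simp_all
  qed
  then show ?thesis
    by (rule countable_image_inj_on[rotated]) simp
qed

text \<open>A convex subset of the line can differ from its interior only by a least and a greatest
  element.\<close>

lemma countable_diff_interior:
  fixes S :: "real set"
  assumes "convex S"
  shows "countable (S - interior S)"
proof -
  have "S - interior S \<subseteq> {x \<in> S. \<forall>y\<in>S. x \<le> y} \<union> {x \<in> S. \<forall>y\<in>S. y \<le> x}"
  proof
    fix x assume x: "x \<in> S - interior S"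
    show "x \<in> {x \<in> S. \<forall>y\<in>S. x \<le> y} \<union> {x \<in> S. \<forall>y\<in>S. y \<le> x}"
    proof (rule ccontr)
      assume "\<not> ?thesis"
      then obtain a b where ab: "a \<in> S" "b \<in> S" "a < x" "x < b"
        using x by (auto simp: not_le)
      then have "{a<..<b} \<subseteq> S"
        using assms unfolding is_interval_convex_1[symmetric] is_interval_1
        by (meson greaterThanLessThan_iff less_imp_le subsetI)
      then have "x \<in> interior S"
        using ab by (intro interiorI[of "{a<..<b}"]) auto
      then show False using x by simp
    qed
  qed
  moreover have "countable {x \<in> S. \<forall>y\<in>S. x \<le> y}"
  proof (cases "\<exists>x\<in>S. \<forall>y\<in>S. x \<le> y")
    case True
    then obtain m where "m \<in> S" "\<forall>y\<in>S. m \<le> y" by blast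
    then have "{x \<in> S. \<forall>y\<in>S. x \<le> y} \<subseteq> {m}" by (auto intro: order_antisym)
    then show ?thesis by (rule countable_subset) simp
  next
    case False
    then have "{x \<in> S. \<forall>y\<in>S. x \<le> y} = {}" by blast
    then show ?thesis by (simp only: countable_empty)
  qed
  moreover have "countable {x \<in> S. \<forall>y\<in>S. y \<le> x}"
  proof (cases "\<exists>x\<in>S. \<forall>y\<in>S. y \<le> x")
    case True
    then obtain m where "m \<in> S" "\<forall>y\<in>S. y \<le> m" by blast
    then have "{x \<in> S. \<forall>y\<in>S. y \<le> x} \<subseteq> {m}" by (auto intro: order_antisym)
    then show ?thesis by (rule countable_subset) simp
  next
    case False
    then have "{x \<in> S. \<forall>y\<in>S. y \<le> x} = {}" by blast
    then show ?thesis by (simp only: countable_empty)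
  qed
  ultimately show ?thesis
    by (meson countable_Un countable_subset)
qed

lemma subgrad_exists_interior:
  assumes "u \<in> Conv" "x \<in> interior (effective_dom u)"
  shows "\<exists>s. subgrad u x s"
proof -
  define f where "f = (\<lambda>x. real_of_ereal (u x))"
  \<comment> \<open>The infimum of the difference quotients to the right, that is, the right
    derivative at \<open>x\<close>.\<close>
  define s where "s = Inf ((\<lambda>t. (f x - f t) / (x - t)) ` ({x<..} \<inter> effective_dom u))"
  have s: "f y \<ge> f x + s * (y - x)" if "y \<in> effective_dom u" for y
    using convex_le_Inf_differential[OF convex_on_effective_dom[OF assms(1)] assms(2) that]
    unfolding f_def s_def .
  have f: "u y = ereal (f y)" if "y \<in> effective_dom u" for y
    unfolding f_def by (rule effective_domE[OF assms(1) that]) simp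
  have "ereal (f x + s * (y - x)) \<le> u y" for y
    using f[of y] s[of y] not_mem_effective_dom[OF assms(1), of y]
    by (metis ereal_less_eq(1,3))
  moreover have "u x = ereal (f x)"
    using f interior_subset assms(2) by blast
  ultimately show ?thesis
    unfolding subgrad_def by blast
qed

text \<open>If \<open>u\<close> stayed above the line of slope \<open>s + e\<close> on the right,
  then \<open>s + e\<close> would be a second subgradient, since on the left that line lies below
  the one of slope \<open>s\<close>. The witness \<open>b\<close> is the single test point used in
  later limits.\<close>

lemma unique_subgrad_right:
  assumes "subgrad u x s" "\<And>t. subgrad u x t \<Longrightarrow> t = s" "u x = ereal r" "0 < e"
  shows "\<exists>b>x. u b < ereal (r + (s + e) * (b - x))"
proof (rule ccontr)
  assume "\<not> ?thesis"
  then have *: "ereal (r + (s + e) * (b - x)) \<le> u b" if "x < b" for b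
    using that by (metis not_less)
  have s: "ereal (r + s * (y - x)) \<le> u y" for y
    using assms(1,3) by (auto simp: subgrad_def)
  have "ereal (r + (s + e) * (y - x)) \<le> u y" for y
  proof (cases "x < y")
    case False
    then have "(s + e) * (y - x) \<le> s * (y - x)"
      using assms(4) by (simp add: mult_right_mono_neg)
    then show ?thesis
      using s[of y] by (metis add_left_mono ereal_less_eq(3) order_trans)
  qed (rule *)
  then have "subgrad u x (s + e)"
    using assms(3) by (auto simp: subgrad_def)
  then show False
    using assms(2,4) by fastforce
qed

lemma unique_subgrad_left:
  assumes "subgrad u x s" "\<And>t. subgrad u x t \<Longrightarrow> t = s" "u x = ereal r" "0 < e"
  shows "\<exists>a<x. u a < ereal (r + (s - e) * (a - x))"
proof (rule ccontr)
  assume "\<not> ?thesis"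
  then have *: "ereal (r + (s - e) * (b - x)) \<le> u b" if "b < x" for b
    using that by (metis not_less)
  have s: "ereal (r + s * (y - x)) \<le> u y" for y
    using assms(1,3) by (auto simp: subgrad_def)
  have "ereal (r + (s - e) * (y - x)) \<le> u y" for y
  proof (cases "y < x")
    case False
    then have "(s - e) * (y - x) \<le> s * (y - x)"
      using assms(4) by (simp add: mult_right_mono)
    then show ?thesis
      using s[of y] by (metis add_left_mono ereal_less_eq(3) order_trans)
  qed (rule *)
  then have "subgrad u x (s - e)"
    using assms(3) by (auto simp: subgrad_def)
  then show False
    using assms(2,4) by fastforce
qed

text \<open>The difference quotient is squeezed: the subgradient bounds it on one side, and on the
  other side so do the chords from \<open>x\<close> to points whose slopes come within
  \<open>e / 2\<close> of \<open>s\<close>.\<close>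

lemma ereal_deriv_unique_subgrad:
  assumes "u \<in> Conv" and s: "subgrad u x s" and unique: "\<And>t. subgrad u x t \<Longrightarrow> t = s"
  shows "ereal_deriv u x = s"
proof -
  define f where "f = (\<lambda>y. real_of_ereal (u y))"
  obtain r where r: "u x = ereal r" and sub: "\<And>y. ereal (r + s * (y - x)) \<le> u y"
    using s by (auto simp: subgrad_def)
  have fx: "f x = r" by (simp add: f_def r)
  have "((\<lambda>y. (f y - f x) / (y - x)) \<longlongrightarrow> s) (at x)"
  proof (rule tendstoI)
    fix e :: real assume "0 < e"
    then have e2: "0 < e / 2" by simp
    obtain b where b: "x < b" "u b < ereal (r + (s + e / 2) * (b - x))"
      using unique_subgrad_right[OF s unique r e2] by auto
    obtain a where a: "a < x" "u a < ereal (r + (s - e / 2) * (a - x))"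
      using unique_subgrad_left[OF s unique r e2] by auto
    have "\<forall>\<^sub>F y in at x. y \<in> {a<..<b}"
      using a(1) b(1) by (intro eventually_at_in_open') auto
    moreover have "\<forall>\<^sub>F y in at x. y \<noteq> x"
      by (simp add: eventually_at_filter)
    ultimately show "\<forall>\<^sub>F y in at x. dist ((f y - f x) / (y - x)) s < e"
    proof eventually_elim
      case (elim y)
      have up: "u y \<le> ereal (r + (s + e / 2) * (y - x))" if "x < y"
        using Conv_le_chord[OF assms(1), of x r b "r + (s + e / 2) * (b - x)" y] that b elim r
        by (auto simp: closed_segment_eq_real_ivl less_imp_le)
      have dn: "u y \<le> ereal (r + (s - e / 2) * (y - x))" if "y < x"
        using Conv_le_chord[OF assms(1), of x r a "r + (s - e / 2) * (a - x)" y] that a elim r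
        by (auto simp: closed_segment_eq_real_ivl less_imp_le)
      have "y \<in> effective_dom u"
        using up dn elim effective_domI_le[OF assms(1)] by (metis linorder_neqE_linordered_idom)
      then obtain q where q: "u y = ereal q"
        using effective_domE assms(1) by blast
      have fy: "f y = q" by (simp add: f_def q)
      have lo: "r + s * (y - x) \<le> q"
        using sub[of y] q by simp
      show ?case
      proof (cases "x < y")
        case True
        then have "s \<le> (q - r) / (y - x)" "(q - r) / (y - x) \<le> s + e / 2"
          using up q lo by (auto simp: field_simps)
        then show ?thesis
          using \<open>0 < e\<close> by (simp add: fx fy dist_real_def)
      next
        case False
        then have "y < x" using elim by simp
        then have "(q - r) / (y - x) \<le> s" "s - e / 2 \<le> (q - r) / (y - x)"
          using dn q lo by (auto simp: field_simps)
        then show ?thesis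
          using \<open>0 < e\<close> by (simp add: fx fy dist_real_def)
      qed
    qed
  qed
  then have "(f has_field_derivative s) (at x)"
    by (simp add: has_field_derivative_iff)
  then show ?thesis
    unfolding ereal_deriv_def f_def by (rule DERIV_imp_deriv)
qed

text \<open>Off this set \<open>ereal_deriv\<close> may be read as the only subgradient. It also
  catches the endpoints of the domain that belong to it, where subgradients are absent or form an
  unbounded set.\<close>

definition kinks :: "(real \<Rightarrow> ereal) \<Rightarrow> real set" where
  "kinks u = {x \<in> effective_dom u. \<not> (\<forall>s. subgrad u x s \<longleftrightarrow> s = ereal_deriv u x)}"

lemma countable_kinks:
  assumes "u \<in> Conv"
  shows "countable (kinks u)"
proof -
  have "kinks u \<subseteq> (effective_dom u - interior (effective_dom u)) \<union>
      {x. \<exists>s t. s < t \<and> subgrad u x s \<and> subgrad u x t}"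
  proof
    fix x assume x: "x \<in> kinks u"
    show "x \<in> (effective_dom u - interior (effective_dom u)) \<union>
      {x. \<exists>s t. s < t \<and> subgrad u x s \<and> subgrad u x t}"
    proof (rule ccontr)
      assume *: "\<not> ?thesis"
      then have "x \<in> interior (effective_dom u)"
        using x by (auto simp: kinks_def)
      then obtain s where s: "subgrad u x s"
        using subgrad_exists_interior assms by blast
      have "\<not> a < b" if "subgrad u x a" "subgrad u x b" for a b
        using * that by blast
      then have unique: "t = s" if "subgrad u x t" for t
        using s that by (meson linorder_less_linear)
      then have "ereal_deriv u x = s"
        using ereal_deriv_unique_subgrad assms s by blast
      then show False
        using x s unique unfolding kinks_def by blast
    qed
  qed
  then show ?thesis
    using countable_diff_interior[OF convex_effective_dom[OF assms]] countable_nonunique_subgrad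
    by (meson countable_Un countable_subset)
qed

lemma subgrad_iff_ereal_deriv:
  assumes "x \<in> effective_dom u" "x \<notin> kinks u"
  shows "subgrad u x s \<longleftrightarrow> s = ereal_deriv u x"
  using assms by (auto simp: kinks_def)

lemma countable_AE_lborel:
  fixes N :: "real set"
  assumes "countable N"
  shows "AE x in lborel. x \<notin> N"
  using countable_imp_null_set_lborel[OF assms] by (rule AE_not_in)

lemma Conv_scD: "u \<in> Conv_sc \<Longrightarrow> u \<in> Conv"
  by (simp add: Conv_sc_def)

section \<open>Epi-convergence and subgradients\<close>

lemma epi_convergesD_less:
  assumes "epi_converges us u" "xs \<longlonglongrightarrow> x" "c < u x"
  shows "\<forall>\<^sub>F k in sequentially. c < us k (xs k)"
  using assms unfolding epi_converges_def le_Liminf_iff by blast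

lemma epi_converges_recovery:
  assumes "epi_converges us u"
  obtains xs where "xs \<longlonglongrightarrow> x" "(\<lambda>k. us k (xs k)) \<longlonglongrightarrow> u x"
  using assms unfolding epi_converges_def by blast

text \<open>Where \<open>u\<close> is infinite, the liminf inequality for the constant sequence
  already forces divergence, so recovery sequences are demanded only at finite values.\<close>

lemma epi_convergesI:
  assumes less: "\<And>x xs c. xs \<longlonglongrightarrow> x \<Longrightarrow> ereal c < u x \<Longrightarrow> \<forall>\<^sub>F k in sequentially. ereal c \<le> us k (xs k)"
    and recovery: "\<And>x. u x \<noteq> \<infinity> \<Longrightarrow> \<exists>xs. xs \<longlonglongrightarrow> x \<and> (\<lambda>k. us k (xs k)) \<longlonglongrightarrow> u x"
  shows "epi_converges us u"
proof -
  have liminf: "u x \<le> liminf (\<lambda>k. us k (xs k))" if xs: "xs \<longlonglongrightarrow> x" for x xs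
    unfolding le_Liminf_iff
  proof (intro allI impI)
    fix c assume "c < u x"
    then obtain d where d: "c < ereal d" "ereal d < u x"
      using ereal_dense2 by blast
    show "\<forall>\<^sub>F k in sequentially. c < us k (xs k)"
      using less[OF xs d(2)] by eventually_elim (use d(1) in order)
  qed
  have "\<exists>xs. xs \<longlonglongrightarrow> x \<and> (\<lambda>k. us k (xs k)) \<longlonglongrightarrow> u x" for x
  proof (cases "u x = \<infinity>")
    case True
    have "\<infinity> \<le> liminf (\<lambda>k. us k x)"
      using liminf[of "\<lambda>_. x" x] True by simp
    then have "(\<lambda>k. us k x) \<longlonglongrightarrow> \<infinity>"
      by (simp add: Liminf_PInfty)
    then show ?thesis
      using True by (intro exI[of _ "\<lambda>_. x"]) simp
  qed (rule recovery)
  then show ?thesis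
    using liminf by (simp add: epi_converges_def)
qed

lemma epi_converges_const:
  assumes "u \<in> Conv"
  shows "epi_converges (\<lambda>_. u) u"
proof (rule epi_convergesI)
  fix x xs c assume xs: "xs \<longlonglongrightarrow> x" and c: "ereal c < u x"
  have "\<forall>\<^sub>F y in nhds x. ereal c < u y"
    using assms c by (intro lower_semicontinuousD) (auto simp: Conv_def)
  then have "\<forall>\<^sub>F k in sequentially. ereal c < u (xs k)"
    using xs unfolding filterlim_iff by blast
  then show "\<forall>\<^sub>F k in sequentially. ereal c \<le> u (xs k)"
    by eventually_elim simp
qed (auto intro: exI[of _ "\<lambda>_. _"])

text \<open>Testing the subgradient inequality at \<open>p\<close> puts the value at
  \<open>x\<close> below the cone of slope \<open>M\<close> with apex \<open>(p, C)\<close>;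
  convexity carries the bound to the whole segment.\<close>

lemma subgrad_cone_bound:
  assumes "u \<in> Conv" and s: "subgrad u x s" "\<bar>s\<bar> \<le> M" and p: "u p \<le> ereal C"
    and z: "z \<in> closed_segment p x"
  shows "u z \<le> ereal (C + M * \<bar>z - p\<bar>)"
proof -
  obtain t where t: "0 \<le> t" "t \<le> 1" "z = (1 - t) * p + t * x"
    using z by (auto simp: in_segment)
  obtain r where r: "u x = ereal r" "ereal (r + s * (p - x)) \<le> u p"
    using s(1) by (auto simp: subgrad_def)
  have "s * (x - p) \<le> \<bar>s\<bar> * \<bar>x - p\<bar>"
    by (metis abs_ge_self abs_mult)
  also have "\<dots> \<le> M * \<bar>x - p\<bar>"
    using s(2) by (rule mult_right_mono) simp
  finally have "s * (x - p) \<le> M * \<bar>x - p\<bar>" .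
  moreover have "r + s * (p - x) \<le> C"
    using r(2) p by (metis ereal_less_eq(3) order_trans)
  ultimately have "r \<le> C + M * \<bar>x - p\<bar>"
    by (simp add: algebra_simps)
  then have "u z \<le> ereal ((1 - t) * C + t * (C + M * \<bar>x - p\<bar>))"
    unfolding t(3) using r(1) t(1,2) p by (intro Conv_le_convex_combination assms(1)) simp_all
  moreover have "\<bar>z - p\<bar> = t * \<bar>x - p\<bar>"
  proof -
    have "z - p = t * (x - p)"
      by (simp add: t(3) algebra_simps)
    then show ?thesis
      using t(1) by (simp add: abs_mult)
  qed
  ultimately show ?thesis
    by (simp add: algebra_simps)
qed

text \<open>A subgradient of modulus at most \<open>M\<close> at a point \<open>x\<close> beyond \<open>R\<close> would, by convexity, force the
  value at \<open>R\<close> below a cone of slope \<open>M\<close>; super-coercivity of the limit excludes this for large \<open>R\<close>.\<close>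

lemma subgrad_support_bound:
  assumes us: "\<And>k. us k \<in> Conv" and u: "u \<in> Conv_sc" and epi: "epi_converges us u" and "0 \<le> M"
  shows "\<exists>R. \<forall>\<^sub>F k in sequentially. \<forall>x s. subgrad (us k) x s \<longrightarrow> \<bar>s\<bar> \<le> M \<longrightarrow> \<bar>x\<bar> \<le> R"
proof -
  obtain p where p: "p \<in> effective_dom u"
    using effective_dom_nonempty Conv_scD[OF u] by blast
  then obtain c where c: "u p = ereal c"
    using effective_domE Conv_scD[OF u] by blast
  obtain ps where ps: "ps \<longlonglongrightarrow> p" "(\<lambda>k. us k (ps k)) \<longlonglongrightarrow> u p"
    using epi_converges_recovery[OF epi] by blast
  obtain R0 where R0: "\<And>x. R0 \<le> \<bar>x\<bar> \<Longrightarrow> ereal ((M + 1) * \<bar>x\<bar>) \<le> u x"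
    using u unfolding Conv_sc_def super_coercive_iff by blast
  define K where "K = \<bar>c + 1 + M * (\<bar>p\<bar> + 1)\<bar>"
  \<comment> \<open>Large enough for three purposes: coercivity holds at \<open>R\<close> and
    \<open>- R\<close>, the growth \<open>(M + 1) * R\<close> beats the cone
    \<open>c + 1 + M * (R + \<bar>p\<bar> + 1)\<close>, and points within 1 of \<open>p\<close> lie
    in \<open>[-R, R]\<close>.\<close>
  define R where "R = \<bar>R0\<bar> + \<bar>p\<bar> + K + 2"
  have "K \<ge> 0" by (simp add: K_def)
  have less: "ereal (c + 1 + M * (R + \<bar>p\<bar> + 1)) < u z" if "\<bar>z\<bar> = R" for z
  proof -
    have "c + 1 + M * (R + \<bar>p\<bar> + 1) < (M + 1) * R"
      unfolding K_def R_def by (simp add: algebra_simps)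
    also have "ereal \<dots> \<le> u z"
      using R0[of z] that \<open>K \<ge> 0\<close> by (simp add: R_def)
    finally show ?thesis by simp
  qed
  have "\<forall>\<^sub>F k in sequentially. ereal (c + 1 + M * (R + \<bar>p\<bar> + 1)) < us k R"
    "\<forall>\<^sub>F k in sequentially. ereal (c + 1 + M * (R + \<bar>p\<bar> + 1)) < us k (- R)"
    by (intro epi_convergesD_less[OF epi tendsto_const] less; use \<open>K \<ge> 0\<close> in \<open>simp add: R_def\<close>)+
  moreover have "\<forall>\<^sub>F k in sequentially. us k (ps k) < ereal (c + 1)"
    using ps(2) c by (intro order_tendstoD(2)) auto
  moreover have "\<forall>\<^sub>F k in sequentially. dist (ps k) p < 1"
    using ps(1) by (intro tendstoD) auto
  ultimately have "\<forall>\<^sub>F k in sequentially. \<forall>x s. subgrad (us k) x s \<longrightarrow> \<bar>s\<bar> \<le> M \<longrightarrow> \<bar>x\<bar> \<le> R"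
  proof eventually_elim
    case (elim k)
    have pk: "\<bar>ps k\<bar> \<le> \<bar>p\<bar> + 1"
      using elim(4) by (simp add: dist_real_def)
    have no: "\<not> z \<in> closed_segment (ps k) x"
      if "\<bar>z\<bar> = R" "subgrad (us k) x s" "\<bar>s\<bar> \<le> M" for x s z
    proof
      assume "z \<in> closed_segment (ps k) x"
      then have "us k z \<le> ereal (c + 1 + M * \<bar>z - ps k\<bar>)"
        using that elim(3) by (intro subgrad_cone_bound[OF us]) auto
      also have "\<bar>z - ps k\<bar> \<le> R + \<bar>p\<bar> + 1"
        using that(1) pk by simp
      then have "M * \<bar>z - ps k\<bar> \<le> M * (R + \<bar>p\<bar> + 1)"
        using \<open>0 \<le> M\<close> by (rule mult_left_mono)
      then have "ereal (c + 1 + M * \<bar>z - ps k\<bar>) \<le> ereal (c + 1 + M * (R + \<bar>p\<bar> + 1))"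
        by simp
      also have "\<dots> < us k z"
        using elim(1,2) that(1) by (cases "0 \<le> z") (auto simp: abs_if split: if_splits)
      finally show False by simp
    qed
    have "\<bar>ps k\<bar> \<le> R"
      using pk \<open>K \<ge> 0\<close> by (simp add: R_def)
    \<comment> \<open>A segment that starts in \<open>[-R, R]\<close> and ends outside passes
      through \<open>R\<close> or \<open>- R\<close>, where the cone bound is violated.\<close>
    then have "R \<in> closed_segment (ps k) x \<or> - R \<in> closed_segment (ps k) x" if "\<not> \<bar>x\<bar> \<le> R" for x
      using that by (auto simp: closed_segment_eq_real_ivl abs_le_iff)
    moreover have "\<bar>R\<bar> = R" "\<bar>- R\<bar> = R"
      using \<open>\<bar>ps k\<bar> \<le> R\<close> by simp_all
    ultimately show ?case
      using no by blast
  qed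
  then show ?thesis ..
qed

text \<open>The cone bound at \<open>x\<close> itself: a subgradient of modulus at most
  \<open>M\<close> would keep \<open>us k x\<close> bounded, while these values tend to
  infinity.\<close>

lemma subgrad_unbounded_outside_dom:
  assumes us: "\<And>k. us k \<in> Conv" and u: "u \<in> Conv" and epi: "epi_converges us u"
    and x: "x \<notin> effective_dom u" and "0 \<le> M"
  shows "\<forall>\<^sub>F k in sequentially. \<forall>s. subgrad (us k) x s \<longrightarrow> M < \<bar>s\<bar>"
proof -
  obtain p where p: "p \<in> effective_dom u"
    using effective_dom_nonempty u by blast
  then obtain c where c: "u p = ereal c"
    using effective_domE u by blast
  obtain ps where ps: "ps \<longlonglongrightarrow> p" "(\<lambda>k. us k (ps k)) \<longlonglongrightarrow> u p"
    using epi_converges_recovery[OF epi] by blast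
  have "\<forall>\<^sub>F k in sequentially. ereal (c + 1 + M * (\<bar>x - p\<bar> + 1)) < us k x"
    using not_mem_effective_dom[OF u x] by (intro epi_convergesD_less[OF epi tendsto_const]) simp
  moreover have "\<forall>\<^sub>F k in sequentially. us k (ps k) < ereal (c + 1)"
    using ps(2) c by (intro order_tendstoD(2)) auto
  moreover have "\<forall>\<^sub>F k in sequentially. dist (ps k) p < 1"
    using ps(1) by (intro tendstoD) auto
  ultimately show ?thesis
  proof eventually_elim
    case (elim k)
    have "\<not> \<bar>s\<bar> \<le> M" if "subgrad (us k) x s" for s
    proof
      assume "\<bar>s\<bar> \<le> M"
      then have "us k x \<le> ereal (c + 1 + M * \<bar>x - ps k\<bar>)"
        using that elim(2) by (intro subgrad_cone_bound[OF us]) auto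
      also have "\<bar>x - ps k\<bar> \<le> \<bar>x - p\<bar> + 1"
        using elim(3) by (simp add: dist_real_def)
      then have "M * \<bar>x - ps k\<bar> \<le> M * (\<bar>x - p\<bar> + 1)"
        using \<open>0 \<le> M\<close> by (rule mult_left_mono)
      then have "ereal (c + 1 + M * \<bar>x - ps k\<bar>) \<le> ereal (c + 1 + M * (\<bar>x - p\<bar> + 1))"
        by simp
      also have "\<dots> < us k x" by (rule elim(1))
      finally show False by simp
    qed
    then show ?case by (auto simp: not_le)
  qed
qed

text \<open>The strict inequality at \<open>b\<close> persists along a recovery sequence
  \<open>bs\<close> for \<open>b\<close>, and \<open>us k x\<close> cannot drop far below
  \<open>r\<close>, so slopes of \<open>us k\<close> at \<open>x\<close> stay on the correct side of
  \<open>w\<close>. The product form treats \<open>b\<close> to the right and to the left of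
  \<open>x\<close> at once.\<close>

lemma epi_converges_slope_bound:
  assumes us: "\<And>k. us k \<in> Conv" and u: "u \<in> Conv" and epi: "epi_converges us u"
    and r: "u x = ereal r" and b: "b \<noteq> x" "u b < ereal (r + w * (b - x))"
  shows "\<forall>\<^sub>F k in sequentially. \<exists>b'. b' \<in> effective_dom (us k) \<and> 0 < (b' - x) * (b - x) \<and>
    (\<forall>t. subgrad (us k) x t \<longrightarrow> t * (b' - x) < w * (b' - x))"
proof -
  have "b \<in> effective_dom u"
    using effective_domI_le[OF u less_imp_le] b(2) by blast
  then obtain \<beta> where \<beta>: "u b = ereal \<beta>"
    using effective_domE u by blast
  \<comment> \<open>A third of the gap, one share for each error: the value at \<open>bs k\<close>,
    the value at \<open>x\<close>, and the displacement of \<open>b\<close> to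
    \<open>bs k\<close>.\<close>
  define \<delta> where "\<delta> = (r + w * (b - x) - \<beta>) / 3"
  have "0 < \<delta>"
    using b(2) by (simp add: \<beta> \<delta>_def)
  obtain bs where bs: "bs \<longlonglongrightarrow> b" "(\<lambda>k. us k (bs k)) \<longlonglongrightarrow> u b"
    using epi_converges_recovery[OF epi] by blast
  have "\<forall>\<^sub>F k in sequentially. us k (bs k) < ereal (\<beta> + \<delta>)"
    using bs(2) \<beta> \<open>0 < \<delta>\<close> by (intro order_tendstoD(2)) auto
  moreover have "\<forall>\<^sub>F k in sequentially. ereal (r - \<delta>) < us k x"
    using \<open>0 < \<delta>\<close> r by (intro epi_convergesD_less[OF epi tendsto_const]) simp
  moreover have "(\<lambda>k. w * (bs k - x)) \<longlonglongrightarrow> w * (b - x)"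
    by (intro tendsto_intros bs(1))
  then have "\<forall>\<^sub>F k in sequentially. w * (b - x) - \<delta> < w * (bs k - x)"
    using \<open>0 < \<delta>\<close> by (intro order_tendstoD(1)) auto
  moreover have "(\<lambda>k. (bs k - x) * (b - x)) \<longlonglongrightarrow> (b - x) * (b - x)"
    by (intro tendsto_intros bs(1))
  then have "\<forall>\<^sub>F k in sequentially. 0 < (bs k - x) * (b - x)"
    by (rule order_tendstoD(1)) (use b(1) in \<open>auto simp: zero_less_mult_iff\<close>)
  ultimately show ?thesis
  proof eventually_elim
    case (elim k)
    have "t * (bs k - x) < w * (bs k - x)" if t: "subgrad (us k) x t" for t
    proof -
      obtain q where q: "us k x = ereal q" "ereal (q + t * (bs k - x)) \<le> us k (bs k)"
        using t by (auto simp: subgrad_def)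
      have "ereal (q + t * (bs k - x)) < ereal (\<beta> + \<delta>)"
        using q(2) elim(1) by (rule le_less_trans)
      moreover have "3 * \<delta> = r + w * (b - x) - \<beta>"
        by (simp add: \<delta>_def)
      moreover have "r - \<delta> < q"
        using elim(2) q(1) by simp
      ultimately show ?thesis
        using elim(3) unfolding less_ereal.simps by linarith
    qed
    moreover have "bs k \<in> effective_dom (us k)"
      using effective_domI_le[OF us less_imp_le[OF elim(1)]] .
    ultimately show ?case
      using elim(4) by blast
  qed
qed

text \<open>The slope bound is used with \<open>s + e\<close> to the right and \<open>s - e\<close>
  to the left. The two nearby domain points also enclose \<open>x\<close>, which settles the
  indicator factor of the integrand.\<close>

lemma subgrad_convergence:
  assumes us: "\<And>k. us k \<in> Conv" and u: "u \<in> Conv" and epi: "epi_converges us u"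
    and s: "subgrad u x s" and unique: "\<And>t. subgrad u x t \<Longrightarrow> t = s" and "0 < e"
  shows "\<forall>\<^sub>F k in sequentially. x \<in> effective_dom (us k) \<and> (\<forall>t. subgrad (us k) x t \<longrightarrow> \<bar>t - s\<bar> < e)"
proof -
  obtain r where r: "u x = ereal r"
    using s by (auto simp: subgrad_def)
  obtain b where b: "x < b" "u b < ereal (r + (s + e) * (b - x))"
    using unique_subgrad_right[OF s unique r \<open>0 < e\<close>] by auto
  obtain a where a: "a < x" "u a < ereal (r + (s - e) * (a - x))"
    using unique_subgrad_left[OF s unique r \<open>0 < e\<close>] by auto
  have "b \<noteq> x" "a \<noteq> x" using a(1) b(1) by auto
  from epi_converges_slope_bound[OF us u epi r this(1) b(2)]
    epi_converges_slope_bound[OF us u epi r this(2) a(2)]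
  show ?thesis
  proof eventually_elim
    case (elim k)
    obtain b' where b': "b' \<in> effective_dom (us k)" "x < b'"
      "\<And>t. subgrad (us k) x t \<Longrightarrow> t * (b' - x) < (s + e) * (b' - x)"
      using elim(1) b(1) by (auto simp: zero_less_mult_iff)
    obtain a' where a': "a' \<in> effective_dom (us k)" "a' < x"
      "\<And>t. subgrad (us k) x t \<Longrightarrow> t * (a' - x) < (s - e) * (a' - x)"
      using elim(2) a(1) by (auto simp: zero_less_mult_iff)
    have "x \<in> effective_dom (us k)"
      using effective_dom_between[OF us a'(1) b'(1)] a'(2) b'(2) by simp
    moreover have "\<bar>t - s\<bar> < e" if "subgrad (us k) x t" for t
      using b'(3)[OF that] a'(3)[OF that] a'(2) b'(2)
      by (auto simp: mult_less_cancel_right abs_less_iff)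
    ultimately show ?case by blast
  qed
qed

section \<open>The integral functional\<close>

lemma C_cE:
  assumes "z \<in> C_c"
  obtains M B where "0 \<le> M" "\<And>t. M < \<bar>t\<bar> \<Longrightarrow> z t = 0" "\<And>t. \<bar>z t\<bar> \<le> B" "0 \<le> B"
    "continuous_on UNIV z"
proof -
  let ?K = "closure {t. z t \<noteq> 0}"
  have K: "compact ?K" and cont: "continuous_on UNIV z"
    using assms by (auto simp: C_c_def)
  obtain M where M: "\<And>t. t \<in> ?K \<Longrightarrow> \<bar>t\<bar> \<le> M"
    using compact_imp_bounded[OF K] by (auto simp: bounded_iff)
  have "compact (z ` ?K)"
    by (intro compact_continuous_image K continuous_on_subset[OF cont]) auto
  then have "bounded (z ` ?K)"
    by (rule compact_imp_bounded)
  then obtain B where "\<forall>y\<in>z ` ?K. norm y \<le> B"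
    unfolding bounded_iff ..
  then have B: "\<bar>z t\<bar> \<le> B" if "t \<in> ?K" for t
    using that by simp
  have sub: "t \<in> ?K" if "z t \<noteq> 0" for t
    using that closure_subset[of "{t. z t \<noteq> 0}"] by (auto simp del: closure_subset)
  show thesis
  proof (rule that[of "\<bar>M\<bar>" "\<bar>B\<bar>"])
    show "z t = 0" if "\<bar>M\<bar> < \<bar>t\<bar>" for t
      using M[OF sub] that by force
    show "\<bar>z t\<bar> \<le> \<bar>B\<bar>" for t
      using B[OF sub, of t] by (cases "z t = 0") auto
  qed (simp_all add: cont)
qed

definition grad_integrand :: "(real \<Rightarrow> real) \<Rightarrow> (real \<Rightarrow> ereal) \<Rightarrow> real \<Rightarrow> real" where
  "grad_integrand z u x = indicator (effective_dom u) x * z (ereal_deriv u x)"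

lemma set_integral_eq_grad_integrand:
  "(LBINT x:effective_dom u. z (ereal_deriv u x)) = integral\<^sup>L lborel (grad_integrand z u)"
  by (simp add: set_lebesgue_integral_def grad_integrand_def[abs_def])

text \<open>Any selection of subgradients on the interior of the domain is monotone, hence Borel,
  and it agrees with the derivative off a countable set.\<close>

lemma grad_integrand_measurable:
  assumes "u \<in> Conv" "continuous_on UNIV z"
  shows "grad_integrand z u \<in> borel_measurable borel"
proof -
  define S where "S = interior (effective_dom u)"
  define D where "D x = (SOME s. subgrad u x s)" for x
  have D: "subgrad u x (D x)" if "x \<in> S" for x
    unfolding D_def by (rule someI_ex, rule subgrad_exists_interior[OF assms(1)])
      (use that in \<open>simp add: S_def\<close>)
  have "mono_on S D"
  proof (rule mono_onI)
    fix x y assume "x \<in> S" "y \<in> S" "x \<le> y"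
    then show "D x \<le> D y"
      using subgrad_mono[OF D D, of x y] by (cases "x = y") auto
  qed
  then have "D \<in> borel_measurable (restrict_space borel S)"
    by (rule borel_measurable_mono_on_fnc)
  then have "(\<lambda>x. z (D x)) \<in> borel_measurable (restrict_space borel S)"
    by (rule measurable_compose[OF _ borel_measurable_continuous_onI[OF assms(2)]])
  then have meas: "(\<lambda>x. indicator S x *\<^sub>R z (D x)) \<in> borel_measurable borel"
    by (subst (asm) borel_measurable_restrict_space_iff) (auto simp: S_def)
  show ?thesis
  proof (rule measurable_discrete_difference[OF meas])
    show "countable (kinks u \<union> (effective_dom u - S))"
      unfolding S_def
      using countable_kinks countable_diff_interior convex_effective_dom assms(1) by auto
    show "indicator S x *\<^sub>R z (D x) = grad_integrand z u x"
      if "x \<notin> kinks u \<union> (effective_dom u - S)" for x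
    proof (cases "x \<in> S")
      case True
      then have "x \<in> effective_dom u"
        using interior_subset by (auto simp: S_def)
      then have "D x = ereal_deriv u x"
        using D[OF True] subgrad_iff_ereal_deriv that by auto
      then show ?thesis
        using True \<open>x \<in> effective_dom u\<close> by (simp add: grad_integrand_def)
    next
      case False
      then show ?thesis
        using that by (simp add: grad_integrand_def)
    qed
  qed auto
qed

text \<open>Dominated convergence yields both claims. Slopes that \<open>z\<close> does not
  annihilate occur only at bounded positions, which provides the majorant
  \<open>B * indicator {-R..R}\<close>.\<close>

lemma grad_integral_epi_convergence:
  assumes us: "\<And>k. us k \<in> Conv" and u: "u \<in> Conv_sc" and epi: "epi_converges us u"
    and z: "z \<in> C_c"
  shows "(\<lambda>k. integral\<^sup>L lborel (grad_integrand z (us k))) \<longlonglongrightarrow> integral\<^sup>L lborel (grad_integrand z u)"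
    and "integrable lborel (grad_integrand z u)"
proof -
  have u': "u \<in> Conv" using u by (rule Conv_scD)
  obtain M B where M: "0 \<le> M" "\<And>t. M < \<bar>t\<bar> \<Longrightarrow> z t = 0" and B: "\<And>t. \<bar>z t\<bar> \<le> B" "0 \<le> B"
    and cont: "continuous_on UNIV z"
    using C_cE[OF z] by blast
  obtain R where "\<forall>\<^sub>F k in sequentially. \<forall>x s. subgrad (us k) x s \<longrightarrow> \<bar>s\<bar> \<le> M \<longrightarrow> \<bar>x\<bar> \<le> R"
    using subgrad_support_bound[OF us u epi M(1)] by blast
  then obtain n where n: "\<And>k x s. n \<le> k \<Longrightarrow> subgrad (us k) x s \<Longrightarrow> \<bar>s\<bar> \<le> M \<Longrightarrow> \<bar>x\<bar> \<le> R"
    by (auto simp: eventually_sequentially)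
  \<comment> \<open>The bound on positions holds only from index \<open>n\<close> on, hence the
    shifted sequence.\<close>
  have meas: "grad_integrand z u \<in> borel_measurable lborel"
    "\<And>k. grad_integrand z (us (k + n)) \<in> borel_measurable lborel"
    using grad_integrand_measurable[OF _ cont] us u' by auto
  have int: "integrable lborel (\<lambda>x. B * indicator {-R..R} x)"
    by (intro integrable_mult_right integrable_real_indicator) (auto simp: emeasure_lborel_Icc_eq)
  have AE: "AE x in lborel. x \<notin> kinks u" "\<And>k. AE x in lborel. x \<notin> kinks (us k)"
    "AE x in lborel. \<forall>k. x \<notin> kinks (us k)"
    using countable_kinks us u' by (auto intro!: countable_AE_lborel simp: AE_all_countable)
  have bound: "AE x in lborel. norm (grad_integrand z (us (k + n)) x) \<le> B * indicator {-R..R} x" for k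
    using AE(2)[of "k + n"]
  proof eventually_elim
    case (elim x)
    let ?t = "ereal_deriv (us (k + n)) x"
    show ?case
    proof (cases "x \<in> effective_dom (us (k + n)) \<and> \<bar>?t\<bar> \<le> M")
      case True
      then have "subgrad (us (k + n)) x ?t"
        using elim subgrad_iff_ereal_deriv by blast
      then have "\<bar>x\<bar> \<le> R"
        using n[of "k + n"] True by simp
      then show ?thesis
        using B True by (auto simp: grad_integrand_def abs_le_iff)
    next
      case False
      then have "grad_integrand z (us (k + n)) x = 0"
        using M(2)[of ?t] by (auto simp: grad_integrand_def)
      then show ?thesis using B(2) by simp
    qed
  qed
  have lim: "AE x in lborel. (\<lambda>k. grad_integrand z (us (k + n)) x) \<longlonglongrightarrow> grad_integrand z u x"
    using AE(1,3)
  proof eventually_elim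
    case (elim x)
    have "(\<lambda>k. grad_integrand z (us k) x) \<longlonglongrightarrow> grad_integrand z u x"
    proof (cases "x \<in> effective_dom u")
      case True
      let ?s = "ereal_deriv u x"
      have s: "subgrad u x ?s" "\<And>t. subgrad u x t \<Longrightarrow> t = ?s"
        using subgrad_iff_ereal_deriv True elim(1) by blast+
      have ev: "\<forall>\<^sub>F k in sequentially. x \<in> effective_dom (us k) \<and> \<bar>ereal_deriv (us k) x - ?s\<bar> < e"
        if "0 < e" for e
      proof -
        have "\<forall>\<^sub>F k in sequentially. x \<in> effective_dom (us k) \<and> (\<forall>t. subgrad (us k) x t \<longrightarrow> \<bar>t - ?s\<bar> < e)"
          using s that by (intro subgrad_convergence[OF us u' epi])
        then show ?thesis
        proof eventually_elim
          case (elim k)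
          then show ?case
            using subgrad_iff_ereal_deriv \<open>\<forall>k. x \<notin> kinks (us k)\<close> by blast
        qed
      qed
      have "(\<lambda>k. ereal_deriv (us k) x) \<longlonglongrightarrow> ?s"
      proof (rule tendstoI)
        show "\<forall>\<^sub>F k in sequentially. dist (ereal_deriv (us k) x) ?s < e" if "0 < e" for e
          using ev[OF that] by eventually_elim (simp add: dist_real_def)
      qed
      then have "(\<lambda>k. z (ereal_deriv (us k) x)) \<longlonglongrightarrow> z ?s"
        by (rule continuous_on_tendsto_compose[OF cont]) auto
      moreover have "\<forall>\<^sub>F k in sequentially. z (ereal_deriv (us k) x) = grad_integrand z (us k) x"
        using ev[of 1] by (auto simp: grad_integrand_def elim: eventually_mono)
      ultimately have "(\<lambda>k. grad_integrand z (us k) x) \<longlonglongrightarrow> z ?s"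
        by (rule Lim_transform_eventually)
      then show ?thesis
        using True by (simp add: grad_integrand_def)
    next
      case False
      \<comment> \<open>Outside the limiting domain the slopes eventually exceed \<open>M\<close>,
        where \<open>z\<close> vanishes.\<close>
      have "\<forall>\<^sub>F k in sequentially. grad_integrand z (us k) x = 0"
        using subgrad_unbounded_outside_dom[OF us u' epi False M(1)]
      proof eventually_elim
        case (elim k)
        then show ?case
          using subgrad_iff_ereal_deriv[of x "us k"] \<open>\<forall>k. x \<notin> kinks (us k)\<close> M(2)
          by (auto simp: grad_integrand_def indicator_def)
      qed
      then show ?thesis
        using False by (simp add: grad_integrand_def tendsto_eventually)
    qed
    then show ?case
      by (rule LIMSEQ_ignore_initial_segment)
  qed
  show "(\<lambda>k. integral\<^sup>L lborel (grad_integrand z (us k))) \<longlonglongrightarrow> integral\<^sup>L lborel (grad_integrand z u)"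
    by (rule LIMSEQ_offset[of _ n], rule integral_dominated_convergence[OF meas int lim bound])
  show "integrable lborel (grad_integrand z u)"
    by (rule integrable_dominated_convergence[OF meas int lim bound])
qed

lemmas integrable_grad_integrand =
  grad_integral_epi_convergence(2)[OF Conv_scD _ epi_converges_const[OF Conv_scD]]

section \<open>Valuation property of the integral\<close>

lemma subgrad_le:
  assumes "subgrad u x s" "u \<le> v" "u x = v x"
  shows "subgrad v x s"
  using assms unfolding subgrad_def le_fun_def by (metis order_trans)

text \<open>A subgradient of the smaller function at a point of contact is one of the larger
  function too; uniqueness off the kinks makes the derivatives equal.\<close>

lemma grad_integrand_touching:
  assumes "u \<in> Conv" "v \<in> Conv" "u \<le> v" "u x = v x" "x \<notin> kinks u" "x \<notin> kinks v"
  shows "grad_integrand z u x = grad_integrand z v x"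
proof (cases "x \<in> effective_dom u")
  case True
  moreover have xv: "x \<in> effective_dom v"
    using True assms(4) by (simp add: effective_dom_def)
  ultimately have "subgrad u x (ereal_deriv u x)"
    using subgrad_iff_ereal_deriv assms(5) by blast
  then have "subgrad v x (ereal_deriv u x)"
    using assms(3,4) by (rule subgrad_le)
  then have "ereal_deriv u x = ereal_deriv v x"
    using subgrad_iff_ereal_deriv assms(6) xv by blast
  then show ?thesis
    using True xv by (simp add: grad_integrand_def)
next
  case False
  then show ?thesis
    using assms(4) by (simp add: grad_integrand_def effective_dom_def)
qed

lemma grad_integral_valuation:
  assumes "u \<in> Conv_sc" "v \<in> Conv_sc" "sup u v \<in> Conv_sc" "inf u v \<in> Conv_sc" and z: "z \<in> C_c"
  shows "integral\<^sup>L lborel (grad_integrand z (sup u v)) + integral\<^sup>L lborel (grad_integrand z (inf u v))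
    = integral\<^sup>L lborel (grad_integrand z u) + integral\<^sup>L lborel (grad_integrand z v)"
proof -
  note int = integrable_grad_integrand[OF _ _ _ z]
  note C = assms(1-4)[THEN Conv_scD]
  have "AE x in lborel. x \<notin> kinks u" "AE x in lborel. x \<notin> kinks v"
    "AE x in lborel. x \<notin> kinks (sup u v)" "AE x in lborel. x \<notin> kinks (inf u v)"
    using C by (auto intro!: countable_AE_lborel countable_kinks)
  then have "AE x in lborel. grad_integrand z (sup u v) x + grad_integrand z (inf u v) x
      = grad_integrand z u x + grad_integrand z v x"
  proof eventually_elim
    case (elim x)
    show ?case
    proof (cases "u x \<le> v x")
      case True
      then have "sup u v x = v x" "inf u v x = u x"
        by (simp_all add: sup.absorb2 inf.absorb1)
      \<comment> \<open>The minimum touches \<open>u\<close> from below and the maximum touches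
        \<open>v\<close> from above at this \<open>x\<close>, so contact applies to both
        pairs.\<close>
      then have "grad_integrand z (inf u v) x = grad_integrand z u x"
        "grad_integrand z v x = grad_integrand z (sup u v) x"
        using C elim by (auto intro!: grad_integrand_touching)
      then show ?thesis by simp
    next
      case False
      then have "sup u v x = u x" "inf u v x = v x"
        by (simp_all add: sup.absorb1 inf.absorb2)
      then have "grad_integrand z (inf u v) x = grad_integrand z v x"
        "grad_integrand z u x = grad_integrand z (sup u v) x"
        using C elim by (auto intro!: grad_integrand_touching)
      then show ?thesis by simp
    qed
  qed
  then have "integral\<^sup>L lborel (\<lambda>x. grad_integrand z (sup u v) x + grad_integrand z (inf u v) x)
      = integral\<^sup>L lborel (\<lambda>x. grad_integrand z u x + grad_integrand z v x)"
    using int assms(1-4) by (intro integral_cong_AE borel_measurable_integrable) auto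
  then show ?thesis
    using int assms(1-4) by simp
qed

section \<open>Translation invariance\<close>

lemma ereal_convexI:
  assumes "\<And>x. u x \<noteq> -\<infinity>"
    and "\<And>x y p q t. u x = ereal p \<Longrightarrow> u y = ereal q \<Longrightarrow> 0 < t \<Longrightarrow> t < 1 \<Longrightarrow>
      u ((1 - t) * x + t * y) \<le> ereal ((1 - t) * p + t * q)"
  shows "ereal_convex u"
  unfolding ereal_convex_def
proof (intro allI ballI)
  fix x y t :: real assume t: "t \<in> {0..1}"
  consider "t = 0" | "t = 1" | "0 < t" "t < 1"
    using t by fastforce
  then show "u ((1 - t) * x + t * y) \<le> ereal (1 - t) * u x + ereal t * u y"
  proof cases
    case 1 then show ?thesis by (simp flip: zero_ereal_def one_ereal_def)
  next
    case 2 then show ?thesis by (simp flip: zero_ereal_def one_ereal_def)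
  next
    case 3
    then show ?thesis
      using assms(1)[of x] assms(1)[of y] assms(2)[of x _ y _ t]
      by (cases "u x"; cases "u y") auto
  qed
qed

lemma Conv_sc_translate:
  assumes "u \<in> Conv_sc"
  shows "(\<lambda>x. u (x - a) + ereal \<alpha>) \<in> Conv_sc" (is "?w \<in> _")
proof -
  have u: "u \<in> Conv" and sc: "super_coercive u"
    using assms by (auto simp: Conv_sc_def)
  have shift: "ereal c < u y + ereal \<alpha> \<longleftrightarrow> ereal (c - \<alpha>) < u y" for c y
    using Conv_not_MInfty[OF u, of y] by (cases "u y") (auto simp: algebra_simps)
  have notM: "?w x \<noteq> -\<infinity>" for x
    using Conv_not_MInfty[OF u, of "x - a"] by (cases "u (x - a)") auto
  have "ereal_convex ?w"
  proof (rule ereal_convexI[OF notM])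
    fix x y p q t assume *: "?w x = ereal p" "?w y = ereal q" "0 < t" "t < (1::real)"
    have "u (x - a) = ereal (p - \<alpha>)" "u (y - a) = ereal (q - \<alpha>)"
      using *(1,2) by (cases "u (x - a)"; cases "u (y - a)"; auto)+
    then have "u ((1 - t) * (x - a) + t * (y - a)) \<le> ereal ((1 - t) * (p - \<alpha>) + t * (q - \<alpha>))"
      using *(3,4) by (intro Conv_le_convex_combination[OF u]) auto
    then have "u ((1 - t) * x + t * y - a) + ereal \<alpha>
        \<le> ereal ((1 - t) * (p - \<alpha>) + t * (q - \<alpha>)) + ereal \<alpha>"
      by (intro add_right_mono) (simp add: algebra_simps)
    then show "?w ((1 - t) * x + t * y) \<le> ereal ((1 - t) * p + t * q)"
      by (simp add: algebra_simps)
  qed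
  moreover have "lower_semicontinuous ?w"
  proof (rule lower_semicontinuousI)
    fix x c assume "ereal c < ?w x"
    then have "\<forall>\<^sub>F y in nhds (x - a). ereal (c - \<alpha>) < u y"
      using u shift by (intro lower_semicontinuousD) (auto simp: Conv_def)
    moreover have "filterlim (\<lambda>y. y - a) (nhds (x - a)) (nhds x)"
      by (intro tendsto_intros filterlim_ident)
    ultimately have "\<forall>\<^sub>F y in nhds x. ereal (c - \<alpha>) < u (y - a)"
      unfolding filterlim_iff by blast
    then show "\<forall>\<^sub>F y in nhds x. ereal c \<le> ?w y"
      by eventually_elim (use shift in \<open>auto intro: less_imp_le\<close>)
  qed
  moreover obtain p where "p \<in> effective_dom u"
    using effective_dom_nonempty[OF u] .
  then obtain r where "u p = ereal r"
    using effective_domE[OF u] by blast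
  then have "?w (p + a) \<noteq> \<infinity>" by simp
  then have "\<exists>x. ?w x \<noteq> \<infinity>" by blast
  moreover have "super_coercive ?w"
    unfolding super_coercive_iff
  proof
    fix M
    \<comment> \<open>Absorbs the cost \<open>(\<bar>M\<bar> + 1) * \<bar>a\<bar>\<close> of the
      shift and the constant \<open>\<alpha>\<close>. Using slope \<open>\<bar>M\<bar> + 1\<close>
      for \<open>u\<close> leaves one spare \<open>\<bar>x\<bar>\<close> to pay for
      \<open>K\<close>.\<close>
    define K where "K = (2 * \<bar>M\<bar> + 1) * \<bar>a\<bar> + \<bar>\<alpha>\<bar>"
    obtain R where R: "\<And>x. R \<le> \<bar>x\<bar> \<Longrightarrow> ereal ((\<bar>M\<bar> + 1) * \<bar>x\<bar>) \<le> u x"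
      using sc unfolding super_coercive_iff by blast
    have "ereal (M * \<bar>x\<bar>) \<le> ?w x" if x: "\<bar>R\<bar> + \<bar>a\<bar> + K \<le> \<bar>x\<bar>" for x
    proof -
      have "0 \<le> K" by (simp add: K_def)
      have "(\<bar>M\<bar> + 1) * \<bar>x\<bar> \<le> (\<bar>M\<bar> + 1) * (\<bar>x - a\<bar> + \<bar>a\<bar>)"
        by (intro mult_left_mono) auto
      also have "\<dots> = (\<bar>M\<bar> + 1) * \<bar>x - a\<bar> + (\<bar>M\<bar> + 1) * \<bar>a\<bar>"
        by (rule distrib_left)
      also have "\<dots> \<le> (\<bar>M\<bar> + 1) * \<bar>x - a\<bar> + K - \<bar>\<alpha>\<bar>"
        unfolding K_def using mult_right_mono[of "\<bar>M\<bar> + 1" "2 * \<bar>M\<bar> + 1" "\<bar>a\<bar>"] by simp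
      finally have "\<bar>M\<bar> * \<bar>x\<bar> + \<bar>x\<bar> \<le> (\<bar>M\<bar> + 1) * \<bar>x - a\<bar> + K - \<bar>\<alpha>\<bar>"
        by (simp only: distrib_right mult_1_left)
      moreover have "M * \<bar>x\<bar> \<le> \<bar>M\<bar> * \<bar>x\<bar>"
        by (intro mult_right_mono) auto
      moreover have "K \<le> \<bar>x\<bar>" "- \<alpha> \<le> \<bar>\<alpha>\<bar>"
        using x by auto
      ultimately have "M * \<bar>x\<bar> - \<alpha> \<le> (\<bar>M\<bar> + 1) * \<bar>x - a\<bar>"
        by argo
      moreover have "ereal ((\<bar>M\<bar> + 1) * \<bar>x - a\<bar>) \<le> u (x - a)"
        using x \<open>0 \<le> K\<close> by (intro R) auto
      ultimately have "ereal (M * \<bar>x\<bar> - \<alpha>) \<le> u (x - a)"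
        by (meson ereal_less_eq(3) order_trans)
      then show ?thesis
        by (cases "u (x - a)") auto
    qed
    then show "\<exists>R. \<forall>x. R \<le> \<bar>x\<bar> \<longrightarrow> ereal (M * \<bar>x\<bar>) \<le> ?w x" by blast
  qed
  ultimately show ?thesis
    using notM by (simp add: Conv_sc_def Conv_def)
qed

lemma grad_integral_translate:
  assumes "u \<in> Conv_sc" "z \<in> C_c"
  shows "integral\<^sup>L lborel (grad_integrand z (\<lambda>x. u (x - a) + ereal \<alpha>)) = integral\<^sup>L lborel (grad_integrand z u)"
    (is "integral\<^sup>L lborel (grad_integrand z ?w) = _")
proof -
  have u: "u \<in> Conv" and w: "?w \<in> Conv"
    using assms(1) Conv_sc_translate Conv_scD by blast+
  have dom: "x \<in> effective_dom ?w \<longleftrightarrow> x - a \<in> effective_dom u" for x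
    by (cases "u (x - a)") (auto simp: effective_dom_def)
  have sub: "subgrad ?w x s" if s: "subgrad u (x - a) s" for x s
  proof -
    obtain r where r: "u (x - a) = ereal r" "\<And>y. ereal (r + s * (y - (x - a))) \<le> u y"
      using s by (auto simp: subgrad_def)
    have "ereal (r + \<alpha> + s * (y - x)) \<le> u (y - a) + ereal \<alpha>" for y
      using r(2)[of "y - a"] by (cases "u (y - a)") (auto simp: algebra_simps)
    then show ?thesis
      using r(1) by (auto simp: subgrad_def)
  qed
  have "countable ((\<lambda>x. x + a) ` kinks u)"
    using countable_kinks[OF u] by simp
  then have "AE x in lborel. x \<notin> (\<lambda>x. x + a) ` kinks u"
    by (rule countable_AE_lborel)
  moreover have "AE x in lborel. x \<notin> kinks ?w"
    by (intro countable_AE_lborel countable_kinks w)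
  \<comment> \<open>The argument \<open>- a + 1 * x\<close> has the shape of the affine substitution
    rule for \<open>lborel\<close>.\<close>
  ultimately have "AE x in lborel. grad_integrand z ?w x = grad_integrand z u (- a + 1 * x)"
  proof eventually_elim
    case (elim x)
    have "x - a \<notin> kinks u"
      using elim(1) by (metis diff_add_cancel image_eqI)
    then have "ereal_deriv u (x - a) = ereal_deriv ?w x" if "x - a \<in> effective_dom u"
      using subgrad_iff_ereal_deriv sub elim(2) dom that by blast
    then show ?case
      using dom by (auto simp: grad_integrand_def indicator_def)
  qed
  moreover have meas: "grad_integrand z ?w \<in> borel_measurable borel"
    "grad_integrand z u \<in> borel_measurable borel"
    using u w assms(2) by (auto intro!: grad_integrand_measurable simp: C_c_def)
  moreover have "(\<lambda>x. grad_integrand z u (- a + 1 * x)) \<in> borel_measurable borel"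
    by (rule measurable_compose[OF _ meas(2)]) measurable
  ultimately have "integral\<^sup>L lborel (grad_integrand z ?w) = (\<integral>x. grad_integrand z u (- a + 1 * x) \<partial>lborel)"
    by (intro integral_cong_AE) simp_all
  also have "\<dots> = integral\<^sup>L lborel (grad_integrand z u)"
    by (subst lborel_integral_real_affine[where c = 1 and t = "- a" and f = "grad_integrand z u"]) auto
  finally show ?thesis .
qed

section \<open>Integral functionals satisfy all three conditions\<close>

lemma grad_integral_epi_continuous_on:
  assumes "z \<in> C_c"
  shows "epi_continuous_on Conv_sc (\<lambda>u. integral\<^sup>L lborel (grad_integrand z u))"
  unfolding epi_continuous_on_def
  using grad_integral_epi_convergence(1)[OF Conv_scD _ _ assms] by blast

lemma grad_integral_epi_translation_invariant_on:
  assumes "z \<in> C_c"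
  shows "epi_translation_invariant_on Conv_sc (\<lambda>u. integral\<^sup>L lborel (grad_integrand z u))"
  unfolding epi_translation_invariant_on_def translation_invariant_on_def
    vertically_translation_invariant_on_def
  using grad_integral_translate[OF _ assms, where \<alpha> = 0]
    grad_integral_translate[OF _ assms, where a = 0]
  by (simp flip: zero_ereal_def)

lemma grad_integral_valuation_on:
  assumes "z \<in> C_c"
  shows "valuation_on Conv_sc (\<lambda>u. integral\<^sup>L lborel (grad_integrand z u))"
  unfolding valuation_on_def using grad_integral_valuation assms by blast

lemma grad_integral_epi_valuation:
  assumes "z \<in> C_c" and Z: "\<And>u. u \<in> Conv_sc \<Longrightarrow> Z u = c + integral\<^sup>L lborel (grad_integrand z u)"
  shows "epi_continuous_on Conv_sc Z \<and> epi_translation_invariant_on Conv_sc Z \<and> valuation_on Conv_sc Z"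
proof (intro conjI)
  show "epi_continuous_on Conv_sc Z"
    using grad_integral_epi_continuous_on[OF assms(1)] unfolding epi_continuous_on_def
    by (auto simp: Z intro!: tendsto_intros)
  \<comment> \<open>\<open>Z\<close> is given by the formula only on \<open>Conv_sc\<close>, so
    translates must be known to remain there.\<close>
  have "(\<lambda>x. u (x - a)) \<in> Conv_sc" "(\<lambda>x. u x + ereal \<alpha>) \<in> Conv_sc" if "u \<in> Conv_sc" for u a \<alpha>
    using Conv_sc_translate[OF that, of a 0] Conv_sc_translate[OF that, of 0 \<alpha>]
    by (simp_all flip: zero_ereal_def)
  then show "epi_translation_invariant_on Conv_sc Z"
    using grad_integral_epi_translation_invariant_on[OF assms(1)]
    unfolding epi_translation_invariant_on_def translation_invariant_on_def
      vertically_translation_invariant_on_def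
    by (simp add: Z)
  show "valuation_on Conv_sc Z"
    using grad_integral_valuation_on[OF assms(1)] unfolding valuation_on_def
    by (fastforce simp: Z)
qed

section \<open>Functions supported on a compact interval\<close>

definition restr :: "(real \<Rightarrow> real) \<Rightarrow> real \<Rightarrow> real \<Rightarrow> real \<Rightarrow> ereal" where
  "restr f a b x = (if x \<in> {a..b} then ereal (f x) else \<infinity>)"

lemma effective_dom_restr: "effective_dom (restr f a b) = {a..b}"
  by (auto simp: effective_dom_def restr_def)

text \<open>Convexity on the whole line makes \<open>f\<close> continuous even at \<open>a\<close>
  and \<open>b\<close>, which gives semicontinuity; super-coercivity comes from the bounded
  domain.\<close>

lemma restr_Conv_sc:
  assumes f: "convex_on UNIV f" and "a \<le> b"
  shows "restr f a b \<in> Conv_sc"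
proof -
  have "ereal_convex (restr f a b)"
  proof (rule ereal_convexI)
    show "restr f a b x \<noteq> -\<infinity>" for x by (simp add: restr_def)
    fix x y p q t assume *: "restr f a b x = ereal p" "restr f a b y = ereal q" "0 < t" "t < (1::real)"
    then have xy: "x \<in> {a..b}" "y \<in> {a..b}" "p = f x" "q = f y"
      by (auto simp: restr_def split: if_splits)
    have "(1 - t) * x + t * y \<in> {a..b}"
      using convexD_alt[OF convex_real_interval(5)[of a b] xy(1,2), of t] *(3,4) by simp
    moreover have "f ((1 - t) * x + t * y) \<le> (1 - t) * f x + t * f y"
      using convex_onD[OF f, of t x y] *(3,4) by simp
    ultimately show "restr f a b ((1 - t) * x + t * y) \<le> ereal ((1 - t) * p + t * q)"
      using xy by (simp add: restr_def)
  qed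
  moreover have "lower_semicontinuous (restr f a b)"
  proof (rule lower_semicontinuousI)
    fix x c assume c: "ereal c < restr f a b x"
    show "\<forall>\<^sub>F y in nhds x. ereal c \<le> restr f a b y"
    proof (cases "x \<in> {a..b}")
      case True
      have "continuous_on UNIV f"
        using f by (intro convex_on_continuous) auto
      then have "(f \<longlongrightarrow> f x) (nhds x)"
        by (simp add: continuous_on_eq_continuous_at continuous_at tendsto_nhds_iff)
      then have "\<forall>\<^sub>F y in nhds x. c < f y"
        using c True by (intro order_tendstoD(1)) (auto simp: restr_def)
      then show ?thesis
        by eventually_elim (simp add: restr_def)
    next
      case False
      then have "\<forall>\<^sub>F y in nhds x. y \<in> - {a..b}"
        by (intro eventually_nhds_in_open) auto
      then show ?thesis
        by eventually_elim (auto simp: restr_def)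
    qed
  qed
  moreover have "\<exists>x. restr f a b x \<noteq> \<infinity>"
    using \<open>a \<le> b\<close> by (auto simp: restr_def)
  ultimately have "restr f a b \<in> Conv"
    by (auto simp: Conv_def restr_def)
  then show ?thesis
    using super_coerciveI_bounded[of "restr f a b"] by (simp add: Conv_sc_def effective_dom_restr)
qed

lemma convex_on_affine: "convex_on UNIV (\<lambda>x::real. t * x + c)"
  by (intro convex_onI) (auto simp: algebra_simps)

lemma convex_on_times: "convex_on UNIV (\<lambda>x::real. t * x)"
  using convex_on_affine[of t 0] by simp

text \<open>The maximum of the two pieces is finite only at the common point \<open>b\<close>, and
  their minimum is the glued function.\<close>

lemma valuation_restr_split:
  assumes "valuation_on Conv_sc Z" "convex_on UNIV f" "a \<le> b" "b \<le> c"
  shows "Z (restr f b b) + Z (restr f a c) = Z (restr f a b) + Z (restr f b c)"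
proof -
  have "sup (restr f a b) (restr f b c) = restr f b b"
    "inf (restr f a b) (restr f b c) = restr f a c"
    using assms(3,4) by (auto simp: restr_def fun_eq_iff)
  then show ?thesis
    using assms restr_Conv_sc unfolding valuation_on_def
    by (metis order_refl order_trans)
qed

lemma restr_affine_invariant:
  assumes "epi_translation_invariant_on Conv_sc Z" "a \<le> b"
  shows "Z (restr (\<lambda>x. t * x + c) a b) = Z (restr (\<lambda>x. t * x) 0 (b - a))"
proof -
  let ?u = "restr (\<lambda>x. t * x) 0 (b - a)"
  have u: "?u \<in> Conv_sc"
    using assms(2) by (intro restr_Conv_sc convex_on_times) simp
  have shift: "(\<lambda>x. ?u (x - a)) \<in> Conv_sc"
    using Conv_sc_translate[OF u, of a 0] by (simp flip: zero_ereal_def)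
  have inv: "\<forall>u\<in>Conv_sc. \<forall>a. Z (\<lambda>x. u (x - a)) = Z u"
    "\<forall>u\<in>Conv_sc. \<forall>\<alpha>. Z (\<lambda>x. u x + ereal \<alpha>) = Z u"
    using assms(1) unfolding epi_translation_invariant_on_def translation_invariant_on_def
      vertically_translation_invariant_on_def by auto
  \<comment> \<open>The vertical shift \<open>t * a + c\<close> is the value of the affine function
    at the left endpoint.\<close>
  have "Z (\<lambda>x. ?u (x - a) + ereal (t * a + c)) = Z (\<lambda>x. ?u (x - a))"
    using inv(2)[rule_format, OF shift] .
  also have "\<dots> = Z ?u"
    using inv(1)[rule_format, OF u] .
  also have "(\<lambda>x. ?u (x - a) + ereal (t * a + c)) = restr (\<lambda>x. t * x + c) a b"
    by (auto simp: restr_def fun_eq_iff algebra_simps)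
  finally show ?thesis .
qed

section \<open>Values on affine functions\<close>

lemma floor_fraction_tendsto:
  "(\<lambda>n. real_of_int \<lfloor>x * real (Suc n)\<rfloor> / real (Suc n)) \<longlonglongrightarrow> x"
proof (rule tendsto_sandwich)
  show "\<forall>\<^sub>F n in sequentially. x - 1 / real (Suc n) \<le> real_of_int \<lfloor>x * real (Suc n)\<rfloor> / real (Suc n)"
  proof (rule always_eventually, rule allI)
    fix n
    have "x * real (Suc n) - 1 \<le> real_of_int \<lfloor>x * real (Suc n)\<rfloor>"
      by linarith
    then have "(x * real (Suc n) - 1) / real (Suc n) \<le> real_of_int \<lfloor>x * real (Suc n)\<rfloor> / real (Suc n)"
      by (rule divide_right_mono) simp
    then show "x - 1 / real (Suc n) \<le> real_of_int \<lfloor>x * real (Suc n)\<rfloor> / real (Suc n)"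
      by (simp add: diff_divide_distrib del: of_nat_Suc)
  qed
  show "\<forall>\<^sub>F n in sequentially. real_of_int \<lfloor>x * real (Suc n)\<rfloor> / real (Suc n) \<le> x"
    by (intro always_eventually allI) (simp add: divide_le_eq del: of_nat_Suc)
  show "(\<lambda>n. x - 1 / real (Suc n)) \<longlonglongrightarrow> x"
    using tendsto_diff[OF tendsto_const LIMSEQ_inverse_real_of_nat, of x]
    by (simp add: inverse_eq_divide del: of_nat_Suc)
qed simp

text \<open>Cauchy's functional equation on the half-line: additivity fixes \<open>f\<close> at
  non-negative fractions, and sequential continuity along floor approximations extends this to
  \<open>x\<close>.\<close>

lemma additive_continuous_linear:
  fixes f :: "real \<Rightarrow> real"
  assumes add: "\<And>x y. 0 \<le> x \<Longrightarrow> 0 \<le> y \<Longrightarrow> f (x + y) = f x + f y"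
    and lim: "\<And>xs x. (\<And>k. 0 \<le> xs k) \<Longrightarrow> 0 \<le> x \<Longrightarrow> xs \<longlonglongrightarrow> x \<Longrightarrow> (\<lambda>k. f (xs k)) \<longlonglongrightarrow> f x"
    and "0 \<le> x"
  shows "f x = f 1 * x"
proof -
  have mult: "f (real n * y) = real n * f y" if "0 \<le> y" for n y
  proof (induction n)
    case 0
    have "f (0 + 0) = f 0 + f 0" by (rule add) auto
    then show ?case by simp
  next
    case (Suc n)
    have "f (real (Suc n) * y) = f (real n * y + y)"
      by (simp add: algebra_simps)
    also have "\<dots> = f (real n * y) + f y"
      using that by (intro add) auto
    finally show ?case
      using Suc by (simp add: algebra_simps)
  qed
  have rat: "f (real m / real (Suc n)) = f 1 * (real m / real (Suc n))" for m n
  proof -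
    have "f 1 = real (Suc n) * f (1 / real (Suc n))"
      using mult[of "1 / real (Suc n)" "Suc n"] by (simp del: of_nat_Suc)
    moreover have "f (real m / real (Suc n)) = real m * f (1 / real (Suc n))"
      using mult[of "1 / real (Suc n)" m] by (simp del: of_nat_Suc)
    ultimately show ?thesis
      by (simp add: field_simps del: of_nat_Suc)
  qed
  define j where "j n = nat \<lfloor>x * real (Suc n)\<rfloor>" for n
  have rj: "real (j n) = of_int \<lfloor>x * real (Suc n)\<rfloor>" for n
    using \<open>0 \<le> x\<close> by (simp add: j_def)
  have j: "(\<lambda>n. real (j n) / real (Suc n)) \<longlonglongrightarrow> x"
    unfolding rj by (rule floor_fraction_tendsto)
  then have "(\<lambda>n. f (real (j n) / real (Suc n))) \<longlonglongrightarrow> f x"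
    using \<open>0 \<le> x\<close> by (intro lim) auto
  moreover have "(\<lambda>n. f (real (j n) / real (Suc n))) \<longlonglongrightarrow> f 1 * x"
    unfolding rat by (intro tendsto_intros j)
  ultimately show ?thesis
    by (rule LIMSEQ_unique)
qed

lemma epi_converges_restr_linear:
  assumes t: "ts \<longlonglongrightarrow> t" and b: "bs \<longlonglongrightarrow> b" and nonneg: "\<And>k. 0 \<le> bs k" "0 \<le> b"
  shows "epi_converges (\<lambda>k. restr (\<lambda>x. ts k * x) 0 (bs k)) (restr (\<lambda>x. t * x) 0 b)"
proof (rule epi_convergesI)
  fix x xs c assume xs: "xs \<longlonglongrightarrow> x" and c: "ereal c < restr (\<lambda>x. t * x) 0 b x"
  show "\<forall>\<^sub>F k in sequentially. ereal c \<le> restr (\<lambda>x. ts k * x) 0 (bs k) (xs k)"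
  proof (cases "x \<in> {0..b}")
    case True
    have "(\<lambda>k. ts k * xs k) \<longlonglongrightarrow> t * x"
      by (intro tendsto_intros t xs)
    then have "\<forall>\<^sub>F k in sequentially. c < ts k * xs k"
      by (rule order_tendstoD(1)) (use c True in \<open>simp add: restr_def\<close>)
    then show ?thesis
      by eventually_elim (simp add: restr_def)
  next
    case False
    then consider "x < 0" | "0 < x - b" by fastforce
    then show ?thesis
    proof cases
      case 1
      then have "\<forall>\<^sub>F k in sequentially. xs k < 0"
        using xs by (rule order_tendstoD(2)[rotated])
      then show ?thesis
        by eventually_elim (simp add: restr_def)
    next
      case 2
      have "(\<lambda>k. xs k - bs k) \<longlonglongrightarrow> x - b"
        by (intro tendsto_intros xs b)
      then have "\<forall>\<^sub>F k in sequentially. 0 < xs k - bs k"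
        using 2 by (rule order_tendstoD(1))
      then show ?thesis
        by eventually_elim (simp add: restr_def)
    qed
  qed
next
  fix x assume "restr (\<lambda>x. t * x) 0 b x \<noteq> \<infinity>"
  then have x: "x \<in> {0..b}"
    by (metis restr_def)
  \<comment> \<open>Moving \<open>x\<close> back to \<open>bs k\<close> when necessary keeps the
    recovery points inside the varying domains.\<close>
  have "(\<lambda>k. min x (bs k)) \<longlonglongrightarrow> min x b"
    by (intro tendsto_intros b)
  then have lim: "(\<lambda>k. min x (bs k)) \<longlonglongrightarrow> x"
    using x by (simp add: min_absorb1)
  have "(\<lambda>k. ereal (ts k * min x (bs k))) \<longlonglongrightarrow> ereal (t * x)"
    by (intro tendsto_intros t lim)
  then show "\<exists>xs. xs \<longlonglongrightarrow> x \<and>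
      (\<lambda>k. restr (\<lambda>x. ts k * x) 0 (bs k) (xs k)) \<longlonglongrightarrow> restr (\<lambda>x. t * x) 0 b x"
    using lim x nonneg by (intro exI[of _ "\<lambda>k. min x (bs k)"]) (simp add: restr_def)
qed

lemma epi_converges_steep:
  assumes ab: "\<And>k. a k \<le> 0" "\<And>k. 0 \<le> b k"
    and steep: "\<And>k x. x \<in> {a k..b k} \<Longrightarrow> real k * \<bar>x\<bar> \<le> t k * x"
  shows "epi_converges (\<lambda>k. restr (\<lambda>x. t k * x) (a k) (b k)) (restr (\<lambda>x. s * x) 0 0)"
proof (rule epi_convergesI)
  fix x xs c assume xs: "xs \<longlonglongrightarrow> x" and c: "ereal c < restr (\<lambda>x. s * x) 0 0 x"
  have ge: "ereal (real k * \<bar>xs k\<bar>) \<le> restr (\<lambda>x. t k * x) (a k) (b k) (xs k)" for k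
    using steep[of "xs k" k] by (simp add: restr_def)
  have "\<forall>\<^sub>F k in sequentially. c \<le> real k * \<bar>xs k\<bar>"
  proof (cases "x = 0")
    case True
    then have "c < 0" using c by (simp add: restr_def)
    then have "c \<le> real k * \<bar>xs k\<bar>" for k
      using mult_nonneg_nonneg[of "real k" "\<bar>xs k\<bar>"] by linarith
    then show ?thesis by simp
  next
    case False
    have "(\<lambda>k. \<bar>xs k\<bar>) \<longlonglongrightarrow> \<bar>x\<bar>"
      by (intro tendsto_intros xs)
    then have "filterlim (\<lambda>k. \<bar>xs k\<bar> * real k) at_top sequentially"
      using False by (intro filterlim_tendsto_pos_mult_at_top filterlim_real_sequentially) auto
    then show ?thesis
      by (simp add: filterlim_at_top mult.commute)
  qed
  then show "\<forall>\<^sub>F k in sequentially. ereal c \<le> restr (\<lambda>x. t k * x) (a k) (b k) (xs k)"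
    by eventually_elim (use ge in \<open>meson ereal_less_eq(3) order_trans\<close>)
next
  fix x assume "restr (\<lambda>x. s * x) 0 0 x \<noteq> \<infinity>"
  then have "x = 0"
    by (auto simp: restr_def split: if_splits)
  then show "\<exists>xs. xs \<longlonglongrightarrow> x \<and>
      (\<lambda>k. restr (\<lambda>x. t k * x) (a k) (b k) (xs k)) \<longlonglongrightarrow> restr (\<lambda>x. s * x) 0 0 x"
    using ab by (intro exI[of _ "\<lambda>_. 0"]) (simp add: restr_def)
qed

lemma grad_integral_restr_linear:
  assumes "0 \<le> b" and z: "z \<in> C_c"
  shows "integral\<^sup>L lborel (grad_integrand z (restr (\<lambda>x. t * x) 0 b)) = z t * b"
proof -
  let ?u = "restr (\<lambda>x. t * x) 0 b"
  have u: "?u \<in> Conv"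
    using assms(1) by (intro Conv_scD restr_Conv_sc convex_on_times)
  have "AE x in lborel. grad_integrand z ?u x = z t * indicator {0..b} x"
    using countable_AE_lborel[OF countable_kinks[OF u]]
  proof eventually_elim
    case (elim x)
    have "ereal_deriv ?u x = t" if x: "x \<in> {0..b}"
    proof -
      have "subgrad ?u x t"
        using x by (auto simp: subgrad_def restr_def algebra_simps)
      then show ?thesis
        using subgrad_iff_ereal_deriv[of x ?u t] elim x by (simp add: effective_dom_restr)
    qed
    then show ?case
      by (cases "x \<in> {0..b}") (simp_all add: grad_integrand_def effective_dom_restr)
  qed
  then have "integral\<^sup>L lborel (grad_integrand z ?u) = (\<integral>x. z t * indicator {0..b} x \<partial>lborel)"
    using grad_integrand_measurable[OF u] z by (intro integral_cong_AE) (auto simp: C_c_def)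
  also have "\<dots> = z t * b"
    using assms(1) by simp
  finally show ?thesis .
qed

section \<open>The density of a given valuation\<close>

locale epi_valuation =
  fixes Z :: "(real \<Rightarrow> ereal) \<Rightarrow> real"
  assumes continuous: "epi_continuous_on Conv_sc Z"
    and invariant: "epi_translation_invariant_on Conv_sc Z"
    and valuation: "valuation_on Conv_sc Z"
begin

text \<open>The future \<open>\<zeta>\<^sub>0\<close>. The indicator of the origin is written with
  slope 0 so that it belongs to the family of linear pieces.\<close>

definition base_value :: real where
  "base_value = Z (restr (\<lambda>x. 0 * x) 0 0)"

definition density :: "real \<Rightarrow> real" where
  "density t = Z (restr (\<lambda>x. t * x) 0 1) - base_value"

lemma limit:
  assumes "\<And>k. us k \<in> Conv_sc" "u \<in> Conv_sc" "epi_converges us u"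
  shows "(\<lambda>k. Z (us k)) \<longlonglongrightarrow> Z u"
  using continuous assms unfolding epi_continuous_on_def by blast

lemma value_point: "Z (restr (\<lambda>x. t * x) 0 0) = base_value"
proof -
  have "restr (\<lambda>x. t * x) 0 0 = restr (\<lambda>x. 0 * x) 0 0"
    by (auto simp: restr_def fun_eq_iff)
  then show ?thesis
    unfolding base_value_def by (rule arg_cong)
qed

lemma value_affine:
  assumes "a \<le> b"
  shows "Z (restr (\<lambda>x. t * x + c) a b) = base_value + density t * (b - a)"
proof -
  define F where "F y = Z (restr (\<lambda>x. t * x) 0 y) - base_value" for y
  have "F (b - a) = F 1 * (b - a)"
  proof (rule additive_continuous_linear)
    fix x y :: real assume xy: "0 \<le> x" "0 \<le> y"
    have lin: "Z (restr (\<lambda>x. t * x) p q) = Z (restr (\<lambda>x. t * x) 0 (q - p))" if "p \<le> q" for p q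
      using restr_affine_invariant[OF invariant that, of t 0] by simp
    \<comment> \<open>Both point values in this identity equal \<open>base_value\<close> after
      translation, so subtracting it leaves an additive \<open>F\<close>.\<close>
    have "Z (restr (\<lambda>x. t * x) x x) + Z (restr (\<lambda>x. t * x) 0 (x + y))
        = Z (restr (\<lambda>x. t * x) 0 x) + Z (restr (\<lambda>x. t * x) x (x + y))"
      using xy by (intro valuation_restr_split valuation convex_on_times) auto
    then show "F (x + y) = F x + F y"
      using lin[of x x] lin[of x "x + y"] xy value_point[of t] by (simp add: F_def)
  next
    fix xs x assume "\<And>k. 0 \<le> xs k" "0 \<le> x" "xs \<longlonglongrightarrow> (x::real)"
    then show "(\<lambda>k. F (xs k)) \<longlonglongrightarrow> F x"
      unfolding F_def
      by (intro tendsto_intros limit restr_Conv_sc convex_on_times epi_converges_restr_linear)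
  qed (use assms in simp)
  then show ?thesis
    using restr_affine_invariant[OF invariant assms, of t c] by (simp add: F_def density_def)
qed

lemma density_continuous: "continuous_on UNIV density"
  unfolding continuous_on_sequentially
proof (intro allI ballI impI, elim conjE)
  fix ts t assume "ts \<longlonglongrightarrow> (t::real)"
  then show "(density \<circ> ts) \<longlonglongrightarrow> density t"
    unfolding density_def comp_def
    by (intro tendsto_intros limit restr_Conv_sc convex_on_times epi_converges_restr_linear) auto
qed

text \<open>Pieces of slope \<open>t k\<close> and length \<open>1 / \<bar>density (t k)\<bar>\<close> would collapse to a point as
  \<open>\<bar>t k\<bar> \<rightarrow> \<infinity>\<close>, although the functional keeps distance 1 from its value at the point.\<close>

lemma density_bounded_support: "bounded {t. density t \<noteq> 0}"
proof (rule ccontr)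
  assume "\<not> ?thesis"
  then have "\<exists>t. density t \<noteq> 0 \<and> real k \<le> \<bar>t\<bar>" for k
    unfolding bounded_iff by (auto simp: not_le) (meson less_imp_le)
  then obtain t where t: "\<And>k. density (t k) \<noteq> 0" "\<And>k. real k \<le> \<bar>t k\<bar>"
    by metis
  define l where "l k = 1 / \<bar>density (t k)\<bar>" for k
  \<comment> \<open>The interval extends to the side of 0 on which the function of slope
    \<open>t k\<close> is non-negative.\<close>
  define a where "a k = (if 0 \<le> t k then 0 else - l k)" for k
  define b where "b k = (if 0 \<le> t k then l k else 0)" for k
  have l: "0 \<le> l k" for k by (simp add: l_def)
  have ab: "a k \<le> 0" "0 \<le> b k" "b k - a k = l k" for k
    using l[of k] by (auto simp: a_def b_def)
  have steep: "real k * \<bar>x\<bar> \<le> t k * x" if x: "x \<in> {a k..b k}" for k x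
  proof -
    have "t k * x = \<bar>t k\<bar> * \<bar>x\<bar>"
      using x by (cases "0 \<le> t k") (auto simp: a_def b_def abs_if)
    then show ?thesis
      using t(2)[of k] by (simp add: mult_right_mono)
  qed
  have "(\<lambda>k. Z (restr (\<lambda>x. t k * x) (a k) (b k))) \<longlonglongrightarrow> Z (restr (\<lambda>x. 0 * x) 0 0)"
    using ab steep order_trans[OF ab(1,2)]
    by (intro limit restr_Conv_sc convex_on_times epi_converges_steep) auto
  moreover have "Z (restr (\<lambda>x. t k * x) (a k) (b k)) = base_value + density (t k) * l k" for k
    using value_affine[OF order_trans[OF ab(1,2)], of "t k" 0 k] ab(3) by simp
  ultimately have "(\<lambda>k. base_value + density (t k) * l k) \<longlonglongrightarrow> base_value"
    by (simp only: value_point)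
  then have "(\<lambda>k. \<bar>base_value + density (t k) * l k - base_value\<bar>) \<longlonglongrightarrow> \<bar>base_value - base_value\<bar>"
    by (intro tendsto_intros)
  moreover have "\<bar>density (t k) * l k\<bar> = 1" for k
    using t(1)[of k] by (simp add: l_def abs_mult)
  ultimately show False
    by (simp add: LIMSEQ_const_iff)
qed

lemma density_C_c: "density \<in> C_c"
  using density_continuous density_bounded_support
  by (simp add: C_c_def compact_closure)

end

section \<open>Density of piecewise affine functions\<close>

text \<open>The liminf inequality is inherited from lower semicontinuity of
  \<open>u\<close>.\<close>

lemma epi_converges_from_above:
  assumes "u \<in> Conv" and above: "\<And>k x. u x \<le> us k x"
    and recovery: "\<And>x. u x \<noteq> \<infinity> \<Longrightarrow> \<exists>xs. xs \<longlonglongrightarrow> x \<and> (\<lambda>k. us k (xs k)) \<longlonglongrightarrow> u x"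
  shows "epi_converges us u"
proof (rule epi_convergesI[OF _ recovery])
  fix x xs c assume "xs \<longlonglongrightarrow> x" "ereal c < u x"
  then have "\<forall>\<^sub>F k in sequentially. ereal c < u (xs k)"
    using epi_convergesD_less[OF epi_converges_const[OF assms(1)]] by blast
  then show "\<forall>\<^sub>F k in sequentially. ereal c \<le> us k (xs k)"
    by eventually_elim (use above in \<open>meson less_imp_le less_le_trans\<close>)
qed

text \<open>Monotonicity of difference quotients: beyond its endpoints, an extended chord runs below
  the graph.\<close>

lemma chord_le_outside:
  fixes f :: "real \<Rightarrow> real"
  assumes "convex_on S f" "p \<in> S" "q \<in> S" "x \<in> S" "p < q" "x \<le> p \<or> q \<le> x"
  shows "f p + (f q - f p) / (q - p) * (x - p) \<le> f x"
proof -
  consider "x = p" | "x = q" | "x < p" | "q < x"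
    using assms(6) by fastforce
  then show ?thesis
  proof cases
    case 3
    have "(f x - f p) / (x - p) \<le> (f p - f q) / (p - q)"
      using convex_on_slope_le[OF assms(1) assms(4,3) 3 assms(5)] by linarith
    also have "(f p - f q) / (p - q) = (f q - f p) / (q - p)"
      by (metis minus_diff_eq minus_divide_divide)
    finally have "(f q - f p) / (q - p) * (x - p) \<le> (f x - f p) / (x - p) * (x - p)"
      using 3 by (intro mult_right_mono_neg) auto
    then show ?thesis using 3 by simp
  next
    case 4
    have "(f p - f q) / (p - q) \<le> (f p - f x) / (p - x)"
      using convex_on_slope_le[OF assms(1) assms(2,4) assms(5) 4] by linarith
    then have "(f q - f p) / (q - p) \<le> (f x - f p) / (x - p)"
      by (metis minus_diff_eq minus_divide_divide)
    then have "(f q - f p) / (q - p) * (x - p) \<le> (f x - f p) / (x - p) * (x - p)"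
      using 4 assms(5) by (intro mult_right_mono) auto
    then show ?thesis using 4 assms(5) by simp
  qed (use assms(5) in auto)
qed

lemma affine_le_between:
  fixes s :: real
  assumes "s * p + c \<le> t * p + d" "s * q + c \<le> t * q + d" "p \<le> x" "x \<le> q"
  shows "s * x + c \<le> t * x + d"
proof (cases "s \<le> t")
  case True
  then have "(t - s) * p \<le> (t - s) * x"
    using assms(3) by (intro mult_left_mono) auto
  then show ?thesis
    using assms(1) by (simp add: algebra_simps)
next
  case False
  then have "(s - t) * x \<le> (s - t) * q"
    using assms(4) by (intro mult_left_mono) auto
  then show ?thesis
    using assms(2) by (simp add: algebra_simps)
qed

lemma convex_on_Max_affine:
  fixes s c :: "nat \<Rightarrow> real"
  shows "convex_on UNIV (\<lambda>x. Max ((\<lambda>i. s i * x + c i) ` {..n}))"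
proof (rule convex_onI)
  fix t x y :: real assume t: "0 < t" "t < 1"
  let ?f = "\<lambda>x. Max ((\<lambda>i. s i * x + c i) ` {..n})"
  have "s i * ((1 - t) * x + t * y) + c i \<le> (1 - t) * ?f x + t * ?f y" if "i \<le> n" for i
  proof -
    have "s i * ((1 - t) * x + t * y) + c i = (1 - t) * (s i * x + c i) + t * (s i * y + c i)"
      by (simp add: algebra_simps)
    also have "\<dots> \<le> (1 - t) * ?f x + t * ?f y"
      using that t by (intro add_mono mult_left_mono Max_ge) auto
    finally show ?thesis .
  qed
  then show "?f ((1 - t) *\<^sub>R x + t *\<^sub>R y) \<le> (1 - t) * ?f x + t * ?f y"
    by simp
qed simp

text \<open>Writing the piecewise affine interpolant as a maximum of chords makes its convexity evident.\<close>

lemma Max_chords_eq_interpolant: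
  fixes f :: "real \<Rightarrow> real" and g :: "nat \<Rightarrow> real"
  assumes f: "convex_on S f" and g: "\<And>i. i \<le> Suc n \<Longrightarrow> g i \<in> S" "\<And>i j. i < j \<Longrightarrow> g i < g j"
    and s: "\<And>i. s i = (f (g (Suc i)) - f (g i)) / (g (Suc i) - g i)"
    and j: "j \<le> n" "x \<in> {g j..g (Suc j)}"
  shows "Max ((\<lambda>i. s i * x + (f (g i) - s i * g i)) ` {..n}) = s j * x + (f (g j) - s j * g j)"
proof (rule Max_eqI)
  fix y assume "y \<in> (\<lambda>i. s i * x + (f (g i) - s i * g i)) ` {..n}"
  then obtain i where i: "i \<le> n" "y = s i * x + (f (g i) - s i * g i)" by auto
  \<comment> \<open>No grid point lies strictly inside cell \<open>i\<close>, so at every grid point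
    the extended chord \<open>i\<close> is at most \<open>f\<close>.\<close>
  have below: "s i * g m + (f (g i) - s i * g i) \<le> f (g m)" if "m \<le> Suc n" for m
  proof -
    have "g m \<le> g i \<or> g (Suc i) \<le> g m"
    proof (cases "m \<le> i")
      case True
      then show ?thesis
        using g(2)[of m i] by (cases "m = i") auto
    next
      case False
      then show ?thesis
        using g(2)[of "Suc i" m] by (cases "m = Suc i") auto
    qed
    then have "f (g i) + s i * (g m - g i) \<le> f (g m)"
      unfolding s using g(1)[of i] g(1)[of "Suc i"] g(1)[of m] g(2)[of i "Suc i"] i(1) that
      by (intro chord_le_outside[OF f]) auto
    then show ?thesis by (simp add: algebra_simps)
  qed
  \<comment> \<open>Chord \<open>j\<close> meets the graph at both ends of its cell, so
    \<open>below\<close> compares chord \<open>i\<close> with chord \<open>j\<close> at these two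
    ends.\<close>
  have "g j < g (Suc j)" using g(2) by simp
  then have "s j * (g (Suc j) - g j) = f (g (Suc j)) - f (g j)"
    unfolding s by simp
  then have "s j * g (Suc j) + (f (g j) - s j * g j) = f (g (Suc j))"
    unfolding right_diff_distrib by linarith
  then have right: "s i * g (Suc j) + (f (g i) - s i * g i) \<le> s j * g (Suc j) + (f (g j) - s j * g j)"
    using below[of "Suc j"] j(1) by linarith
  have left: "s i * g j + (f (g i) - s i * g i) \<le> s j * g j + (f (g j) - s j * g j)"
    using below[of j] j(1) by linarith
  show "y \<le> s j * x + (f (g j) - s j * g j)"
    unfolding i(2) using left right by (rule affine_le_between) (use j(2) in auto)
qed (use j(1) in auto)

text \<open>Meant for the difference between a valuation and its candidate representation.\<close>

locale vanishing_valuation =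
  fixes E :: "(real \<Rightarrow> ereal) \<Rightarrow> real"
  assumes continuous: "epi_continuous_on Conv_sc E"
    and valuation: "valuation_on Conv_sc E"
    and affine: "\<And>t c a b. a \<le> b \<Longrightarrow> E (restr (\<lambda>x. t * x + c) a b) = 0"
begin

lemma vanishes_limit:
  assumes "\<And>k. us k \<in> Conv_sc" "u \<in> Conv_sc" "epi_converges us u" "\<And>k. E (us k) = 0"
  shows "E u = 0"
proof -
  have "(\<lambda>k. E (us k)) \<longlonglongrightarrow> E u"
    using continuous assms(1-3) unfolding epi_continuous_on_def by blast
  then show ?thesis
    by (simp add: assms(4) LIMSEQ_const_iff)
qed

text \<open>Cells are glued one at a time; the correction term lives on a single point, which is a
  degenerate affine piece.\<close>

lemma vanishes_piecewise_affine:
  assumes f: "convex_on UNIV f" and g: "\<And>i. g i \<le> g (Suc i)"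
    and aff: "\<And>i. i < n \<Longrightarrow> \<exists>t c. \<forall>x\<in>{g i..g (Suc i)}. f x = t * x + c"
  shows "E (restr f (g 0) (g n)) = 0"
  using aff
proof (induction n)
  case 0
  have "restr f (g 0) (g 0) = restr (\<lambda>x. 0 * x + f (g 0)) (g 0) (g 0)"
    by (auto simp: restr_def fun_eq_iff)
  then show ?case
    using affine[of "g 0" "g 0" 0 "f (g 0)"] by simp
next
  case (Suc n)
  have "g 0 \<le> g n"
    using lift_Suc_mono_le[of g 0 n] g by blast
  then have "E (restr f (g n) (g n)) + E (restr f (g 0) (g (Suc n)))
      = E (restr f (g 0) (g n)) + E (restr f (g n) (g (Suc n)))"
    using g by (intro valuation_restr_split valuation f)
  moreover have "E (restr f (g 0) (g n)) = 0"
    using Suc by simp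
  moreover obtain t c where tc: "\<And>x. x \<in> {g n..g (Suc n)} \<Longrightarrow> f x = t * x + c"
    using Suc.prems[of n] by auto
  then have "restr f (g n) (g (Suc n)) = restr (\<lambda>x. t * x + c) (g n) (g (Suc n))"
    "restr f (g n) (g n) = restr (\<lambda>x. t * x + c) (g n) (g n)"
    using g[of n] by (auto simp: restr_def fun_eq_iff)
  then have "E (restr f (g n) (g (Suc n))) = 0" "E (restr f (g n) (g n)) = 0"
    using affine g[of n] by simp_all
  ultimately show ?case by simp
qed

text \<open>Chord interpolants on \<open>Suc n\<close> equal cells lie above \<open>u\<close> and
  agree with it on the grid, so grid points approaching \<open>x\<close> form a recovery
  sequence.\<close>

lemma vanishes_compact_dom:
  assumes u: "u \<in> Conv" and dom: "effective_dom u = {a..b}" and "a < b"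
  shows "E u = 0"
proof -
  define f where "f x = real_of_ereal (u x)" for x
  have uf: "u x = ereal (f x)" if "x \<in> {a..b}" for x
    using that unfolding dom[symmetric] f_def by (rule effective_domE[OF u]) simp
  have f: "convex_on {a..b} f"
    using convex_on_effective_dom[OF u] unfolding dom f_def .
  define g where "g n i = a + (b - a) * (real i / real (Suc n))" for n i
  define s where "s n i = (f (g n (Suc i)) - f (g n i)) / (g n (Suc i) - g n i)" for n i
  define h where "h n x = Max ((\<lambda>i. s n i * x + (f (g n i) - s n i * g n i)) ` {..n})" for n x
  have g_less: "g n i < g n j" if "i < j" for n i j
    using that \<open>a < b\<close> unfolding g_def by (intro add_strict_left_mono mult_strict_left_mono divide_strict_right_mono) auto
  have g_mem: "g n i \<in> {a..b}" if "i \<le> Suc n" for n i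
  proof -
    have "(b - a) * (real i / real (Suc n)) \<le> (b - a) * 1"
      using that \<open>a < b\<close> by (intro mult_left_mono) auto
    then show ?thesis
      using \<open>a < b\<close> by (simp add: g_def)
  qed
  have g_ends: "g n 0 = a" "g n (Suc n) = b" for n
    by (simp_all add: g_def)
  have h_convex: "convex_on UNIV (h n)" for n
    unfolding h_def by (rule convex_on_Max_affine)
  have h_eq: "h n x = s n j * x + (f (g n j) - s n j * g n j)"
    if "j \<le> n" "x \<in> {g n j..g n (Suc j)}" for n j x
    unfolding h_def using that g_less g_mem
    by (intro Max_chords_eq_interpolant[OF f]) (auto simp: s_def)
  have h_grid: "h n (g n j) = f (g n j)" if "j \<le> Suc n" for n j
  proof (cases "j \<le> n")
    case True
    then show ?thesis
      using h_eq[of j n "g n j"] g_less[of j "Suc j" n] by simp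
  next
    case False
    then have j: "j = Suc n" using that by simp
    have "s n n * (g n (Suc n) - g n n) = f (g n (Suc n)) - f (g n n)"
      unfolding s_def using g_less[of n "Suc n" n] by simp
    then show ?thesis
      using h_eq[of n n "g n (Suc n)"] g_less[of n "Suc n" n] by (simp add: j algebra_simps)
  qed
  have cell: "\<exists>j\<le>n. x \<in> {g n j..g n (Suc j)}" if "x \<in> {a..b}" for n x
  proof -
    have "\<exists>j\<le>m. x \<in> {g n j..g n (Suc j)}" if "x \<in> {a..g n (Suc m)}" for m
      using that
    proof (induction m)
      case 0
      then show ?case by (simp add: g_ends(1))
    next
      case (Suc m)
      then show ?case
        by (cases "x \<le> g n (Suc m)") (auto intro: le_SucI)
    qed
    then show ?thesis
      using that g_ends(2)[of n] by (metis atLeastAtMost_iff)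
  qed
  have above: "f x \<le> h n x" if x: "x \<in> {a..b}" for n x
  proof -
    obtain j where j: "j \<le> n" "x \<in> {g n j..g n (Suc j)}"
      using cell[OF x] by blast
    have "convex_on {g n j..g n (Suc j)} f"
      using g_mem[of j n] g_mem[of "Suc j" n] j(1) by (intro convex_on_subset[OF f]) auto
    then have "f x \<le> s n j * (x - g n j) + f (g n j)"
      unfolding s_def using convex_onD_Icc'[OF _ j(2)] by blast
    then show ?thesis
      using h_eq[OF j] by (simp add: algebra_simps)
  qed
  have "E (restr (h n) a b) = 0" for n
  proof -
    have "E (restr (h n) (g n 0) (g n (Suc n))) = 0"
    proof (rule vanishes_piecewise_affine[OF h_convex])
      show "g n i \<le> g n (Suc i)" for i
        using g_less[of i "Suc i" n] by simp
      show "\<exists>t c. \<forall>x\<in>{g n i..g n (Suc i)}. h n x = t * x + c" if "i < Suc n" for i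
        using h_eq[of i n] that by auto
    qed
    then show ?thesis
      by (simp only: g_ends)
  qed
  moreover have "epi_converges (\<lambda>n. restr (h n) a b) u"
  proof (rule epi_converges_from_above[OF u])
    show "u x \<le> restr (h k) a b x" for k x
      using above[of x k] uf[of x] by (simp add: restr_def)
    fix x assume "u x \<noteq> \<infinity>"
    then have x: "x \<in> {a..b}"
      using not_mem_effective_dom[OF u] dom by blast
    define \<theta> where "\<theta> = (x - a) / (b - a)"
    have \<theta>: "0 \<le> \<theta>" "\<theta> \<le> 1" "x = a + (b - a) * \<theta>"
      using x \<open>a < b\<close> by (auto simp: \<theta>_def)
    \<comment> \<open>Index of the last grid point not to the right of \<open>x\<close>.\<close>
    define j where "j n = nat \<lfloor>\<theta> * real (Suc n)\<rfloor>" for n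
    have rj: "real (j n) = of_int \<lfloor>\<theta> * real (Suc n)\<rfloor>" for n
      using \<theta>(1) by (simp add: j_def)
    have j_le: "j n \<le> Suc n" for n
    proof -
      have "real (j n) \<le> \<theta> * real (Suc n)"
        unfolding rj by (rule of_int_floor_le)
      also have "\<dots> \<le> 1 * real (Suc n)"
        using \<theta>(2) by (intro mult_right_mono) auto
      finally show ?thesis by simp
    qed
    have "(\<lambda>n. real (j n) / real (Suc n)) \<longlonglongrightarrow> \<theta>"
      unfolding rj by (rule floor_fraction_tendsto)
    then have lim: "(\<lambda>n. g n (j n)) \<longlonglongrightarrow> x"
      unfolding g_def \<theta>(3) by (intro tendsto_intros)
    have "(\<lambda>n. f (g n (j n))) \<longlonglongrightarrow> f x"
    \<comment> \<open>Continuity of \<open>f\<close> is obtained in the open interval. An endpoint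
      is itself a grid point, and there the floor is exact, so the sequence is constant.\<close>
    proof (cases "x \<in> {a<..<b}")
      case True
      have "continuous_on {a<..<b} f"
        by (intro convex_on_continuous convex_on_subset[OF f]) auto
      then have "isCont f x"
        using True by (simp add: continuous_on_eq_continuous_at)
      then show ?thesis
        using lim by (rule isCont_tendsto_compose)
    next
      case False
      then have "\<theta> = 0 \<or> \<theta> = 1"
        using x \<open>a < b\<close> by (auto simp: \<theta>_def)
      then have "g n (j n) = x" for n
        unfolding g_def \<theta>(3) rj by (auto simp del: of_nat_Suc)
      then show ?thesis by simp
    qed
    then have "(\<lambda>n. restr (h n) a b (g n (j n))) \<longlonglongrightarrow> u x"
      using h_grid[OF j_le] g_mem[OF j_le] uf[OF x] by (simp add: restr_def)
    then show "\<exists>xs. xs \<longlonglongrightarrow> x \<and> (\<lambda>n. restr (h n) a b (xs n)) \<longlonglongrightarrow> u x"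
      using lim by blast
  qed
  moreover have "restr (h n) a b \<in> Conv_sc" for n
    using \<open>a < b\<close> by (intro restr_Conv_sc h_convex) simp
  moreover have "u \<in> Conv_sc"
    using u super_coerciveI_bounded[of u] by (simp add: dom Conv_sc_def)
  ultimately show ?thesis
    using vanishes_limit[of "\<lambda>n. restr (h n) a b" u] by blast
qed

text \<open>Replacing \<open>u\<close> by infinity above a height leaves a compact domain, because
  sublevel sets are closed by semicontinuity and bounded by super-coercivity.\<close>

lemma vanishes:
  assumes u: "u \<in> Conv_sc"
  shows "E u = 0"
proof -
  have uC: "u \<in> Conv" and sc: "super_coercive u"
    using u by (auto simp: Conv_sc_def)
  obtain p where "p \<in> effective_dom u"
    using effective_dom_nonempty[OF uC] .
  then obtain m where m: "u p = ereal m"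
    using effective_domE[OF uC] by blast
  \<comment> \<open>Heights start from the value \<open>m\<close> at \<open>p\<close>, so
    \<open>p\<close> belongs to every domain.\<close>
  define cut where "cut k x = (if u x \<le> ereal (m + real k) then u x else \<infinity>)" for k x
  have cut_Conv: "cut k \<in> Conv" for k
  proof -
    have "ereal_convex (cut k)"
    proof (rule ereal_convexI)
      show "cut k x \<noteq> -\<infinity>" for x
        using Conv_not_MInfty[OF uC] by (simp add: cut_def)
      fix x y q r t assume *: "cut k x = ereal q" "cut k y = ereal r" "0 < t" "t < (1::real)"
      then have xy: "u x = ereal q" "u y = ereal r" "q \<le> m + k" "r \<le> m + k"
        by (auto simp: cut_def split: if_splits)
      have le: "u ((1 - t) * x + t * y) \<le> ereal ((1 - t) * q + t * r)"
        using xy *(3,4) by (intro Conv_le_convex_combination[OF uC]) auto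
      also have "(1 - t) * q + t * r \<le> m + k"
        using convex_bound_le[OF xy(3,4), of "1 - t" t] *(3,4) by simp
      finally have "u ((1 - t) * x + t * y) \<le> ereal (m + k)" by simp
      then show "cut k ((1 - t) * x + t * y) \<le> ereal ((1 - t) * q + t * r)"
        using le by (simp add: cut_def)
    qed
    moreover have "lower_semicontinuous (cut k)"
    proof (rule lower_semicontinuousI)
      fix x c assume c: "ereal c < cut k x"
      have ev: "\<forall>\<^sub>F y in nhds x. d < u y" if "d < u x" for d
        using uC that by (intro lower_semicontinuousD) (auto simp: Conv_def)
      \<comment> \<open>Below the height, \<open>cut k\<close> dominates \<open>u\<close>; above it,
        \<open>u\<close> stays above the height nearby and \<open>cut k\<close> is infinite
        there.\<close>
      show "\<forall>\<^sub>F y in nhds x. ereal c \<le> cut k y"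
      proof (cases "u x \<le> ereal (m + k)")
        case True
        then have "ereal c < u x" using c by (simp add: cut_def)
        from ev[OF this] show ?thesis
          by eventually_elim (simp add: cut_def less_imp_le)
      next
        case False
        then have "ereal (m + k) < u x" by simp
        from ev[OF this] show ?thesis
          by eventually_elim (simp add: cut_def not_le[symmetric])
      qed
    qed
    moreover have "cut k p \<noteq> \<infinity>"
      using m by (simp add: cut_def)
    moreover have "cut k x \<noteq> -\<infinity>" for x
      using Conv_not_MInfty[OF uC] by (simp add: cut_def)
    ultimately show ?thesis
      unfolding Conv_def by blast
  qed
  have dom: "effective_dom (cut k) = {x. u x \<le> ereal (m + k)}" for k
    using Conv_not_MInfty[OF uC] by (auto simp: effective_dom_def cut_def)
  have compact: "compact (effective_dom (cut k))" for k
  proof -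
    have "open {x. ereal (m + k) < u x}"
    proof (subst open_subopen, intro ballI)
      fix x assume "x \<in> {x. ereal (m + k) < u x}"
      then have "\<forall>\<^sub>F y in nhds x. ereal (m + k) < u y"
        using uC by (intro lower_semicontinuousD) (auto simp: Conv_def)
      then show "\<exists>T. open T \<and> x \<in> T \<and> T \<subseteq> {x. ereal (m + k) < u x}"
        unfolding eventually_nhds by blast
    qed
    then have "closed {x. u x \<le> ereal (m + k)}"
      by (simp add: closed_def Compl_eq not_le)
    moreover obtain R where R: "\<And>x. R \<le> \<bar>x\<bar> \<Longrightarrow> ereal (1 * \<bar>x\<bar>) \<le> u x"
      using sc unfolding super_coercive_iff by blast
    have "\<bar>x\<bar> \<le> max R (m + k)" if "u x \<le> ereal (m + k)" for x
    proof (cases "R \<le> \<bar>x\<bar>")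
      case True
      then have "ereal \<bar>x\<bar> \<le> ereal (m + k)"
        using R[of x] that by (metis mult_1 order_trans)
      then show ?thesis by simp
    qed simp
    then have "bounded {x. u x \<le> ereal (m + k)}"
      by (auto simp: bounded_iff)
    ultimately show ?thesis
      unfolding dom by (simp add: compact_eq_bounded_closed)
  qed
  have "E (cut k) = 0" for k
  proof -
    have "connected (effective_dom (cut k))"
      by (intro convex_connected convex_effective_dom cut_Conv)
    then obtain a b where ab: "effective_dom (cut k) = {a..b}"
      using connected_compact_interval_1[of "effective_dom (cut k)"] compact[of k] by auto
    have "p \<in> effective_dom (cut k)"
      unfolding dom using m by simp
    \<comment> \<open>When the sublevel set is one point there is no grid; the function is then a
      degenerate affine piece.\<close>
    then consider "a < b" | "a = b"
      using ab by fastforce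
    then show ?thesis
    proof cases
      case 1
      then show ?thesis
        using vanishes_compact_dom[OF cut_Conv ab] by simp
    next
      case 2
      have "a \<in> effective_dom (cut k)"
        by (simp add: ab 2)
      then obtain r where r: "cut k a = ereal r"
        using effective_domE[OF cut_Conv] by blast
      have "cut k = restr (\<lambda>x. 0 * x + r) a a"
        using r not_mem_effective_dom[OF cut_Conv, of _ k] ab 2 by (auto simp: restr_def fun_eq_iff)
      then show ?thesis
        using affine[of a a 0 r] by (simp only: order_refl)
    qed
  qed
  moreover have "epi_converges cut u"
  proof (rule epi_converges_from_above[OF uC])
    show "u x \<le> cut k x" for k x
      by (simp add: cut_def)
    fix x assume "u x \<noteq> \<infinity>"
    then obtain r where r: "u x = ereal r"
      using Conv_not_MInfty[OF uC, of x] by (cases "u x") auto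
    \<comment> \<open>Once \<open>k\<close> is at least \<open>r - m\<close>, the cut no longer
      affects \<open>x\<close>, so the constant sequence is a recovery sequence.\<close>
    have "\<forall>\<^sub>F k in sequentially. cut k x = u x"
      using eventually_ge_at_top[of "nat \<lceil>r - m\<rceil>"]
    proof eventually_elim
      case (elim k)
      then have "r - m \<le> real k" by linarith
      then show ?case using r by (simp add: cut_def)
    qed
    then have "(\<lambda>k. cut k x) \<longlonglongrightarrow> u x"
      by (rule tendsto_eventually)
    then show "\<exists>xs. xs \<longlonglongrightarrow> x \<and> (\<lambda>k. cut k (xs k)) \<longlonglongrightarrow> u x"
      by (intro exI[of _ "\<lambda>_. x"]) simp
  qed
  moreover have "cut k \<in> Conv_sc" for k
    using super_coerciveI_bounded[OF compact_imp_bounded[OF compact] cut_Conv] cut_Conv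
    by (simp add: Conv_sc_def)
  ultimately show ?thesis
    using vanishes_limit[of cut u] u by blast
qed

end

section \<open>Representation of a valuation by its density\<close>

context epi_valuation
begin

lemma representation:
  assumes "u \<in> Conv_sc"
  shows "Z u = base_value + integral\<^sup>L lborel (grad_integrand density u)"
proof -
  let ?I = "\<lambda>u. integral\<^sup>L lborel (grad_integrand density u)"
  interpret E: vanishing_valuation "\<lambda>u. Z u - base_value - ?I u"
  proof
    show "epi_continuous_on Conv_sc (\<lambda>u. Z u - base_value - ?I u)"
      using continuous grad_integral_epi_continuous_on[OF density_C_c]
      unfolding epi_continuous_on_def by (auto intro!: tendsto_intros)
    have "Z (sup u v) - base_value - ?I (sup u v) + (Z (inf u v) - base_value - ?I (inf u v))
        = Z u - base_value - ?I u + (Z v - base_value - ?I v)"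
      if "u \<in> Conv_sc" "v \<in> Conv_sc" "sup u v \<in> Conv_sc" "inf u v \<in> Conv_sc" for u v
    proof -
      have "Z (sup u v) + Z (inf u v) = Z u + Z v" "?I (sup u v) + ?I (inf u v) = ?I u + ?I v"
        using that valuation grad_integral_valuation_on[OF density_C_c]
        unfolding valuation_on_def by blast+
      then show ?thesis by simp
    qed
    then show "valuation_on Conv_sc (\<lambda>u. Z u - base_value - ?I u)"
      unfolding valuation_on_def by blast
    \<comment> \<open>Both functionals contribute \<open>density t * (b - a)\<close>; the integral
      is first moved to \<open>[0, b - a]\<close> by its own translation invariance.\<close>
    show "Z (restr (\<lambda>x. t * x + c) a b) - base_value - ?I (restr (\<lambda>x. t * x + c) a b) = 0"
      if "a \<le> b" for t c a b
      using value_affine[OF that, of t c] grad_integral_restr_linear[OF _ density_C_c, of "b - a" t]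
        restr_affine_invariant[OF grad_integral_epi_translation_invariant_on[OF density_C_c] that, of t c]
        that by simp
  qed
  show ?thesis
    using E.vanishes[OF assms] by simp
qed

end

theorem corollary3:
  fixes Z :: "(real \<Rightarrow> ereal) \<Rightarrow> real"
  shows "(epi_continuous_on Conv_sc Z \<and> epi_translation_invariant_on Conv_sc Z \<and>
            valuation_on Conv_sc Z)
         \<longleftrightarrow>
         (\<exists>\<zeta>\<^sub>0::real. \<exists>\<zeta>\<^sub>1\<in>C_c. \<forall>u\<in>Conv_sc.
            Z u = \<zeta>\<^sub>0 + (LBINT x:effective_dom u. \<zeta>\<^sub>1 (ereal_deriv u x)))"
  unfolding set_integral_eq_grad_integrand
proof
  assume "epi_continuous_on Conv_sc Z \<and> epi_translation_invariant_on Conv_sc Z \<and> valuation_on Conv_sc Z"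
  then interpret epi_valuation Z
    by unfold_locales auto
  show "\<exists>\<zeta>\<^sub>0. \<exists>\<zeta>\<^sub>1\<in>C_c. \<forall>u\<in>Conv_sc. Z u = \<zeta>\<^sub>0 + integral\<^sup>L lborel (grad_integrand \<zeta>\<^sub>1 u)"
    using representation density_C_c by blast
next
  assume "\<exists>\<zeta>\<^sub>0. \<exists>\<zeta>\<^sub>1\<in>C_c. \<forall>u\<in>Conv_sc. Z u = \<zeta>\<^sub>0 + integral\<^sup>L lborel (grad_integrand \<zeta>\<^sub>1 u)"
  then show "epi_continuous_on Conv_sc Z \<and> epi_translation_invariant_on Conv_sc Z \<and> valuation_on Conv_sc Z"
    using grad_integral_epi_valuation by blast
qed

end
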